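(* Let $\mu$ be a probability measure on $E=\mathbb{R}^n$ and $L$ a $\mu$-symmetric diffusion operator with algebra $\mathcal{A}$ and carré du champ $\Gamma$. Suppose that there exist some sublinear ($C^1$, positive, increasing) function $\phi:[1,\infty)\to\mathbb{R}^+$, a smooth enough function $W\ge 1$, and constants $b>0$, $R>0$ such that $$LW\le -\phi(W)+b\,\mathbf{1}_{\{|x|\le R\}} .$$ Suppose also that $\mu$ satisfies a local Poincaré inequality: there exists $\kappa_R$ such that for all nice functions $f$ $$\int_{|x|\le R} f^2\,d\mu\;\le\; \kappa_R\int\Gamma(f)\,d\mu+\mu(\{|x|\le R\})^{-1}\Big(\int_{|x|\le R} f\,d\mu\Big)^2 .$$ Then: (1) for all nice $f$, the following weighted Poincaré inequality holds: $$\mathrm{Var}_\mu(f)\le \max\Big(\frac{b\kappa_R}{\phi(1)},1\Big)\int\Big(1+\frac{1}{\phi'(W)}\Big)\Gamma(f)\,d\mu ;$$ (2) for all nice $f$, the following converse weighted Poincaré inequality holds: $$\inf_{c}\int (f-c)^2\,\frac{\phi(W)}{W}\,d\mu\le (1+b\kappa_R)\int\Gamma(f)\,d\mu ;$$ (3) define $F(u)=\mu(\phi(W)<uW)$ and, for $0<s<1$, $F^{-1}(s):=\inf\{u: F(u)>s\}$; then the following weak Poincaré inequality holds, for some constant $C$, for all such $s$ and all nice $f$: $$\mathrm{Var}_\mu(f)\le \frac{C}{F^{-1}(s)}\int\Gamma(f)\,d\mu+s\,\mathrm{Osc}_\mu(f)^2 .$$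
   Context: Setting: $L$ is a $\mu$-symmetric operator, and there is an algebra $\mathcal{A}$ of bounded functions (the "nice" functions), containing the constant functions, which is everywhere dense (in the $L^2(\mu)$ norm) in the domain of $L$. The carré du champ is defined for $f,g\in\mathcal{A}$ by $L(fg)=fLg+gLf+2\Gamma(f,g)$, with $\Gamma(f):=\Gamma(f,f)$; it is assumed to be a derivation in each component (diffusion case), so that the chain rule $\Gamma(\Psi(f),\Phi(g))=\Psi'(f)\Phi'(g)\Gamma(f,g)$ holds. The main case is $\mu(dx)=Ze^{-V(x)}dx$ with $V$ smooth and $Z$ a normalizing constant, $L=\Delta-\nabla V\cdot\nabla$, $\mathcal{A}$ the $C^\infty$ compactly supported functions plus constants, and $\Gamma(f,g)=\nabla f\cdot\nabla g$. $|x|$ is the Euclidean norm, $\mathrm{Var}_\mu(f)=\int f^2d\mu-(\int f\,d\mu)^2$, and $\mathrm{Osc}_\mu(f)$ is the oscillation of $f$, i.e. its ($\mu$-essential) supremum minus its infimum. The infimum in (2) is over real constants $c$. *)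

theory Defs
  imports "HOL-Probability.Probability" "HOL-Library.Landau_Symbols"
begin

definition carre_du_champ :: "(('a \<Rightarrow> real) \<Rightarrow> 'a \<Rightarrow> real) \<Rightarrow> ('a \<Rightarrow> real) \<Rightarrow> ('a \<Rightarrow> real) \<Rightarrow> 'a \<Rightarrow> real"
  where "carre_du_champ L f g x = (L (\<lambda>y. f y * g y) x - f x * L g x - g x * L f x) / 2"

definition smooth_real :: "(real \<Rightarrow> real) \<Rightarrow> bool"
  where "smooth_real \<Psi> \<longleftrightarrow> (\<forall>k::nat. \<forall>t. ((deriv ^^ k) \<Psi>) differentiable (at t))"

text \<open>
  \<open>L\<close> is an operator on $L^2(\mu)$ with domain \<open>D\<close>, and \<open>\<A>\<close> is its algebra of nice functions.
  The domain consists of actual functions and not of classes, so identities involving \<open>L\<close> are only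
  required almost everywhere. The nonnegativity of the carre du champ is part of \<open>L\<close> being a
  diffusion operator (rather than the opposite of one). The chain rule is required for
  $C^\infty$ functions only, because the algebra of $C^\infty$ compactly supported functions plus
  constants is not stable under less regular ones.
\<close>

locale symmetric_diffusion = prob_space \<mu>
  for \<mu> :: "(real ^ 'n) measure" +
  fixes D :: "(real ^ 'n \<Rightarrow> real) set"
    and \<A> :: "(real ^ 'n \<Rightarrow> real) set"
    and L :: "(real ^ 'n \<Rightarrow> real) \<Rightarrow> real ^ 'n \<Rightarrow> real"
  assumes sets_eq_borel: "sets \<mu> = sets borel"
    and dom_measurable: "f \<in> D \<Longrightarrow> f \<in> borel_measurable \<mu>"
    and dom_L2: "f \<in> D \<Longrightarrow> integrable \<mu> (\<lambda>x. (f x)\<^sup>2)"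
    and L_measurable: "f \<in> D \<Longrightarrow> L f \<in> borel_measurable \<mu>"
    and L_L2: "f \<in> D \<Longrightarrow> integrable \<mu> (\<lambda>x. (L f x)\<^sup>2)"
    and dom_add: "f \<in> D \<Longrightarrow> g \<in> D \<Longrightarrow> (\<lambda>x. f x + g x) \<in> D"
    and dom_scale: "f \<in> D \<Longrightarrow> (\<lambda>x. c * f x) \<in> D"
    and L_cong_AE: "f \<in> D \<Longrightarrow> g \<in> D \<Longrightarrow> AE x in \<mu>. f x = g x \<Longrightarrow> AE x in \<mu>. L f x = L g x"
    and L_add: "f \<in> D \<Longrightarrow> g \<in> D \<Longrightarrow> AE x in \<mu>. L (\<lambda>y. f y + g y) x = L f x + L g x"
    and L_scale: "f \<in> D \<Longrightarrow> AE x in \<mu>. L (\<lambda>y. c * f y) x = c * L f x"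
    and L_symmetric: "f \<in> D \<Longrightarrow> g \<in> D \<Longrightarrow> (\<integral>x. f x * L g x \<partial>\<mu>) = (\<integral>x. g x * L f x \<partial>\<mu>)"
    and alg_subset: "\<A> \<subseteq> D"
    and alg_bounded: "f \<in> \<A> \<Longrightarrow> \<exists>K. \<forall>x. \<bar>f x\<bar> \<le> K"
    and alg_const: "(\<lambda>x. c) \<in> \<A>"
    and alg_add: "f \<in> \<A> \<Longrightarrow> g \<in> \<A> \<Longrightarrow> (\<lambda>x. f x + g x) \<in> \<A>"
    and alg_mult: "f \<in> \<A> \<Longrightarrow> g \<in> \<A> \<Longrightarrow> (\<lambda>x. f x * g x) \<in> \<A>"
    and alg_dense: "f \<in> D \<Longrightarrow> \<epsilon> > 0 \<Longrightarrow> \<exists>g\<in>\<A>. (\<integral>x. (f x - g x)\<^sup>2 \<partial>\<mu>) < \<epsilon>"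
    and gamma_nonneg: "f \<in> \<A> \<Longrightarrow> AE x in \<mu>. 0 \<le> carre_du_champ L f f x"
    and gamma_derivation: "f \<in> \<A> \<Longrightarrow> g \<in> \<A> \<Longrightarrow> h \<in> \<A> \<Longrightarrow>
      AE x in \<mu>. carre_du_champ L (\<lambda>y. f y * g y) h x =
        f x * carre_du_champ L g h x + g x * carre_du_champ L f h x"
    and alg_smooth: "f \<in> \<A> \<Longrightarrow> smooth_real \<Psi> \<Longrightarrow> (\<lambda>x. \<Psi> (f x)) \<in> \<A>"
    and gamma_chain: "f \<in> \<A> \<Longrightarrow> g \<in> \<A> \<Longrightarrow> smooth_real \<Psi> \<Longrightarrow> smooth_real \<Phi> \<Longrightarrow>
      AE x in \<mu>. carre_du_champ L (\<lambda>y. \<Psi> (f y)) (\<lambda>y. \<Phi> (g y)) x =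
        deriv \<Psi> (f x) * deriv \<Phi> (g x) * carre_du_champ L f g x"

definition C2_truncation :: "(real \<Rightarrow> real) \<Rightarrow> (real \<Rightarrow> real) \<Rightarrow> (real \<Rightarrow> real) \<Rightarrow> bool"
  where "C2_truncation T T' T'' \<longleftrightarrow>
    (\<forall>t. (T has_real_derivative T' t) (at t)) \<and>
    (\<forall>t. (T' has_real_derivative T'' t) (at t)) \<and>
    continuous_on UNIV T'' \<and> (\<exists>M. \<forall>t\<ge>M. T' t = 0)"

text \<open>
  A Lyapunov function \<open>W\<close> is typically unbounded and not even in $L^2(\mu)$, so \<open>L W\<close> has to be
  understood in an extended sense: \<open>W\<close> is smooth enough, with image \<open>LW\<close>, if for each $C^2$
  function \<open>T\<close> that is constant near infinity, the bounded function $T(W)$ is a limit of nice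
  functions along which \<open>L\<close> converges in $L^1(\mu)$ to what the diffusion chain rule
  $L(T(W)) = T'(W)\,LW + T''(W)\,\Gamma(W)$ prescribes. In the case $L = \Delta - \nabla V \cdot \nabla$
  this covers the $C^2$ functions \<open>W\<close> tending to infinity at infinity, where $T(W)$ is constant
  outside a compact set and \<open>LW\<close> is the pointwise expression.
\<close>

definition smooth_enough :: "'a measure \<Rightarrow> ('a \<Rightarrow> real) set \<Rightarrow> (('a \<Rightarrow> real) \<Rightarrow> 'a \<Rightarrow> real) \<Rightarrow>
    ('a \<Rightarrow> real) \<Rightarrow> ('a \<Rightarrow> real) \<Rightarrow> bool"
  where "smooth_enough \<mu> \<A> L W LW \<longleftrightarrow>
    W \<in> borel_measurable \<mu> \<and> LW \<in> borel_measurable \<mu> \<and>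
    (\<exists>\<Gamma>W \<in> borel_measurable \<mu>. (AE x in \<mu>. 0 \<le> \<Gamma>W x) \<and>
      (\<forall>T T' T''. C2_truncation T T' T'' \<longrightarrow>
        (\<exists>h :: nat \<Rightarrow> 'a \<Rightarrow> real.
          (\<forall>k. h k \<in> \<A>) \<and>
          (\<exists>K. \<forall>k x. \<bar>h k x\<bar> \<le> K) \<and>
          (AE x in \<mu>. (\<lambda>k. h k x) \<longlonglongrightarrow> T (W x)) \<and>
          (\<lambda>k. \<integral>\<^sup>+ x. ennreal \<bar>L (h k) x - (T' (W x) * LW x + T'' (W x) * \<Gamma>W x)\<bar> \<partial>\<mu>)
            \<longlonglongrightarrow> 0)))"

definition Var :: "'a measure \<Rightarrow> ('a \<Rightarrow> real) \<Rightarrow> real"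
  where "Var \<mu> f = (\<integral>x. (f x)\<^sup>2 \<partial>\<mu>) - (\<integral>x. f x \<partial>\<mu>)\<^sup>2"

definition essinf :: "'a measure \<Rightarrow> ('a \<Rightarrow> ereal) \<Rightarrow> ereal"
  where "essinf \<mu> f = - esssup \<mu> (\<lambda>x. - f x)"

definition Osc :: "'a measure \<Rightarrow> ('a \<Rightarrow> real) \<Rightarrow> real"
  where "Osc \<mu> f = real_of_ereal (esssup \<mu> (\<lambda>x. ereal (f x)) - essinf \<mu> (\<lambda>x. ereal (f x)))"

definition quantile_inv :: "(real \<Rightarrow> real) \<Rightarrow> real \<Rightarrow> real"
  where "quantile_inv F s = Inf {u. F u > s}"

end

theory Submission
  imports Defs
begin

text \<open>
  For a positive increasing $C^1$ function \<open>w\<close>, integration by parts and the Cauchy-Schwarz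
  inequality for \<open>\<Gamma>\<close> give formally
  \[ \int f^2\,\frac{-LW}{w(W)}\,d\mu = \int \Big(\frac{2f}{w(W)}\Gamma(f,W)
     - \frac{f^2 w'(W)}{w(W)^2}\Gamma(W)\Big)d\mu \le \int \frac{\Gamma(f)}{w'(W)}\,d\mu, \]
  and the Lyapunov condition bounds the left-hand side from below by
  $\int f^2 \phi(W)/w(W)\,d\mu - (b/w(1)) \int_{|x|\le R} f^2\,d\mu$. This is applied to $f-c$,
  where \<open>c\<close> is the average of \<open>f\<close> over the ball. The choice $w(t)=t$ leads to the converse
  inequality and $w(t)=\phi(t)+\epsilon t$, $\epsilon\to 0$, to the weighted one. The weak inequality
  follows from the converse one by splitting $\int (f-c)^2\,d\mu$ according to whether $\phi(W)/W$
  is below its quantile.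

  The right-hand side no longer contains $\Gamma(f,W)$ and $\Gamma(W)$, so the inequality only needs
  to be proved for a nice function and a polynomial in place of \<open>W\<close> and $1/w$. It then passes to
  the limit along the nice functions that approximate a truncation $T(W)$; since \<open>T\<close> is concave, the
  term $T''(W)\,\Gamma(W)$ of $L(T(W))$ has the favourable sign and can be dropped.
\<close>

section \<open>Real analysis\<close>

lemma two_mult_le_of_square_le_mult:
  fixes A B C :: real
  assumes "B\<^sup>2 \<le> A * C" "0 \<le> A" "0 \<le> C"
  shows "2 * y * z * B \<le> y\<^sup>2 * C + z\<^sup>2 * A"
proof (rule power2_le_imp_le)
  have "(2 * y * z * B)\<^sup>2 = 4 * (y\<^sup>2 * z\<^sup>2) * B\<^sup>2"
    by (simp add: power_mult_distrib)
  also have "\<dots> \<le> 4 * (y\<^sup>2 * z\<^sup>2) * (A * C)"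
    using assms(1) by (intro mult_left_mono) auto
  also have "\<dots> \<le> (y\<^sup>2 * C + z\<^sup>2 * A)\<^sup>2"
    using zero_le_power2[of "y\<^sup>2 * C - z\<^sup>2 * A"] by (simp add: power2_eq_square algebra_simps)
  finally show "(2 * y * z * B)\<^sup>2 \<le> (y\<^sup>2 * C + z\<^sup>2 * A)\<^sup>2" .
  show "0 \<le> y\<^sup>2 * C + z\<^sup>2 * A" using assms by simp
qed

lemma mult_divide_le_of_weight_ge:
  fixes F t u d v w :: real
  assumes "0 \<le> F" "0 < v" "v \<le> w" "t \<le> - u + d" "0 \<le> d"
  shows "F * t / w \<le> - (F / w * u) + F * d / v"
proof -
  have "F * t / w \<le> F / w * (- u + d)"
    using mult_left_mono[OF assms(4), of "F / w"] assms by simp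
  also have "\<dots> = - (F / w * u) + F * d / w" by (simp add: algebra_simps diff_divide_distrib)
  also have "F * d / w \<le> F * d / v" using assms by (intro divide_left_mono) auto
  finally show ?thesis by simp
qed

lemma square_le_mult_of_quadratic_nonneg:
  fixes A B C :: real
  assumes nonneg: "\<And>q. 0 \<le> A + 2 * q * B + q\<^sup>2 * C"
  shows "B\<^sup>2 \<le> A * C"
proof (cases "C = 0")
  case True
  have "B = 0"
  proof (rule ccontr)
    assume "B \<noteq> 0"
    define q where "q = - (A + 1) / (2 * B)"
    have "2 * q * B = - (A + 1)" using \<open>B \<noteq> 0\<close> by (simp add: q_def)
    then show False using nonneg[of q] True by simp
  qed
  then show ?thesis using True by simp
next
  case False
  have "0 \<le> C"
  proof (rule ccontr)
    assume C: "\<not> 0 \<le> C"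
    define q where "q = sqrt ((A + 1) / (- C))"
    have "q\<^sup>2 * C = - (A + 1)" using C nonneg[of 0] by (simp add: q_def field_simps)
    then show False using nonneg[of q] nonneg[of "- q"] by simp
  qed
  with False have "0 < C" by simp
  then show ?thesis
    using nonneg[of "- B / C"] by (simp add: power2_eq_square field_simps)
qed

lemma abs_square_divide_le:
  fixes a B c d :: real
  assumes "\<bar>a\<bar> \<le> B" "0 < d" "d \<le> c"
  shows "\<bar>a\<^sup>2 / c\<bar> \<le> B\<^sup>2 / d"
proof -
  have "a\<^sup>2 \<le> B\<^sup>2" using assms(1) by (intro abs_le_square_iff[THEN iffD1]) simp
  then show ?thesis using assms(2,3) by (simp add: frac_le)
qed

lemma continuous_imp_bounded_on_abs_le:
  fixes \<psi> :: "real \<Rightarrow> real"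
  assumes "continuous_on UNIV \<psi>"
  obtains B where "\<And>t. \<bar>t\<bar> \<le> K \<Longrightarrow> \<bar>\<psi> t\<bar> \<le> B"
proof -
  have "bounded (\<psi> ` {-K..K})"
    by (intro compact_imp_bounded compact_continuous_image continuous_on_subset[OF assms] compact_Icc)
      simp
  then obtain B where "\<forall>y\<in>\<psi> ` {-K..K}. norm y \<le> B" unfolding bounded_iff by blast
  then have "\<bar>\<psi> t\<bar> \<le> B" if "\<bar>t\<bar> \<le> K" for t using that by (simp add: abs_le_iff)
  then show ?thesis by (rule that)
qed

lemma mono_on_Ici_imp_deriv_nonneg:
  fixes \<phi> :: "real \<Rightarrow> real"
  assumes "mono_on {a..} \<phi>" "(\<phi> has_real_derivative d) (at u within {a..})" "a \<le> u"
  shows "0 \<le> d"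
proof (rule tendsto_lowerbound)
  show "((\<lambda>y. (\<phi> y - \<phi> u) / (y - u)) \<longlongrightarrow> d) (at_right u)"
    unfolding has_field_derivative_iff[symmetric]
    by (rule DERIV_subset[OF assms(2)]) (use assms(3) in auto)
  show "\<forall>\<^sub>F y in at_right u. 0 \<le> (\<phi> y - \<phi> u) / (y - u)"
    using assms(1,3)
    by (auto simp: eventually_at_filter mono_on_def intro!: always_eventually divide_nonneg_pos)
qed simp

lemma has_real_derivative_max_0_power:
  fixes t :: real
  shows "((\<lambda>t. max 0 t ^ Suc (Suc n)) has_real_derivative
    real (Suc (Suc n)) * max 0 t ^ Suc n) (at t)"
proof -
  consider (pos) "t > 0" | (neg) "t < 0" | (zero) "t = 0" by linarith
  then show ?thesis
  proof cases
    case pos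
    show ?thesis
      by (rule has_field_derivative_transform_within_open
            [OF DERIV_pow[of "Suc (Suc n)"], of "{0<..}", THEN DERIV_cong])
        (use pos in auto)
  next
    case neg
    show ?thesis
      by (rule has_field_derivative_transform_within_open
            [OF DERIV_const, of "{..<0}", THEN DERIV_cong])
        (use neg in auto)
  next
    case zero
    have "((\<lambda>h. max 0 h ^ Suc (Suc n) / h) \<longlongrightarrow> 0) (at (0::real))"
    proof (rule Lim_null_comparison)
      show "((\<lambda>h. \<bar>h\<bar> ^ Suc n) \<longlongrightarrow> 0) (at (0::real))"
        by (auto intro!: tendsto_eq_intros)
      show "\<forall>\<^sub>F h in at 0. norm (max 0 h ^ Suc (Suc n) / h) \<le> \<bar>h\<bar> ^ Suc n"
        by (intro always_eventually)
          (auto simp: max_def abs_mult power_abs intro!: mult_nonpos_nonneg)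
    qed
    then show ?thesis using zero by (simp add: DERIV_def)
  qed
qed

definition increasing_weight :: "real \<Rightarrow> (real \<Rightarrow> real) \<Rightarrow> (real \<Rightarrow> real) \<Rightarrow> bool"
  where "increasing_weight a w w' \<longleftrightarrow> continuous_on {a..} w' \<and>
    (\<forall>t\<ge>a. (w has_real_derivative w' t) (at t within {a..}) \<and> 0 < w t \<and> 0 < w' t)"

lemma
  assumes "increasing_weight a w w'"
  shows increasing_weight_deriv_continuous: "continuous_on {a..} w'"
    and increasing_weight_deriv: "\<And>t. a \<le> t \<Longrightarrow> (w has_real_derivative w' t) (at t within {a..})"
    and increasing_weight_pos: "\<And>t. a \<le> t \<Longrightarrow> 0 < w t"
    and increasing_weight_deriv_pos: "\<And>t. a \<le> t \<Longrightarrow> 0 < w' t"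
  using assms by (auto simp: increasing_weight_def)

lemma increasing_weight_continuous:
  assumes "increasing_weight a w w'" shows "continuous_on {a..} w"
  by (rule DERIV_continuous_on[OF increasing_weight_deriv[OF assms]]) auto

lemma increasing_weight_ge:
  assumes w: "increasing_weight a w w'" and "a \<le> t" shows "w a \<le> w t"
proof (rule DERIV_nonneg_imp_increasing_open[OF \<open>a \<le> t\<close>])
  show "\<exists>y. (w has_real_derivative y) (at x) \<and> 0 \<le> y" if "a < x" for x
  proof (intro exI conjI)
    show "(w has_real_derivative w' x) (at x)"
      using increasing_weight_deriv[OF w, of x] that at_within_interior[of x "{a..}"]
      by (simp add: interior_Ici[of "a - 1"])
    show "0 \<le> w' x"
      using increasing_weight_deriv_pos[OF w, of x] that by simp
  qed
  show "continuous_on {a..t} w"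
    by (rule continuous_on_subset[OF increasing_weight_continuous[OF w]]) auto
qed

lemma C1_extension_Ici:
  fixes \<psi> \<psi>' :: "real \<Rightarrow> real"
  assumes deriv: "\<And>t. a \<le> t \<Longrightarrow> (\<psi> has_real_derivative \<psi>' t) (at t within {a..})"
    and cont: "continuous_on {a..} \<psi>'"
  obtains \<Psi> where "\<And>t. (\<Psi> has_real_derivative \<psi>' (max a t)) (at t)" "\<And>t. a \<le> t \<Longrightarrow> \<Psi> t = \<psi> t"
proof -
  have "continuous_on UNIV (\<lambda>t. \<psi>' (max a t))"
    by (rule continuous_on_compose2[OF cont]) (auto intro!: continuous_intros)
  then obtain F where F: "\<And>t. (F has_real_derivative \<psi>' (max a t)) (at t)"
    using einterval_antiderivative[of "-\<infinity>" "\<infinity>" "\<lambda>t. \<psi>' (max a t)"]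
    by (auto simp: continuous_on_eq_continuous_at has_real_derivative_iff_has_vector_derivative)
  have "\<exists>c. \<forall>t\<in>{a..}. \<psi> t - F t = c"
  proof (rule has_field_derivative_zero_constant)
    fix t assume "t \<in> {a..}"
    then have "((\<lambda>t. \<psi> t - F t) has_real_derivative \<psi>' t - \<psi>' (max a t)) (at t within {a..})"
      by (intro DERIV_diff deriv DERIV_subset[OF F]) auto
    with \<open>t \<in> {a..}\<close> show "((\<lambda>t. \<psi> t - F t) has_real_derivative 0) (at t within {a..})" by simp
  qed simp
  then obtain c where c: "\<And>t. a \<le> t \<Longrightarrow> \<psi> t - F t = c" by auto
  show ?thesis
  proof (rule that)
    show "((\<lambda>t. F t + c) has_real_derivative \<psi>' (max a t)) (at t)" for t
      using F by (auto intro!: derivative_eq_intros)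
    show "F t + c = \<psi> t" if "a \<le> t" for t
      using c[OF that] by simp
  qed
qed

lemma real_polynomial_function_antiderivative:
  assumes "real_polynomial_function g"
  obtains p :: "real poly" where "poly (pderiv p) = g" "poly p a = c"
proof -
  obtain b n where g: "g = (\<lambda>t. \<Sum>i\<le>n. b i * t ^ i)"
    using assms by (auto simp: real_polynomial_function_iff_sum)
  define q where "q = (\<Sum>i\<le>n. monom (b i / real (Suc i)) (Suc i))"
  have "pderiv q = (\<Sum>i\<le>n. monom (b i) i)"
    unfolding q_def by (induction n) (simp_all add: pderiv_monom pderiv_add del: of_nat_Suc)
  then have "poly (pderiv (q + [:c - poly q a:])) = g"
    by (auto simp: g pderiv_add pderiv_pCons poly_sum poly_monom)
  then show ?thesis by (rule that) simp
qed

lemma C1_poly_approx: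
  fixes \<psi> \<psi>' :: "real \<Rightarrow> real"
  assumes deriv: "\<And>t. (\<psi> has_real_derivative \<psi>' t) (at t)"
    and cont: "continuous_on UNIV \<psi>'" and "0 < e"
  obtains p where "\<And>t. \<bar>t\<bar> \<le> K \<Longrightarrow> \<bar>poly p t - \<psi> t\<bar> \<le> e"
    "\<And>t. \<bar>t\<bar> \<le> K \<Longrightarrow> \<bar>poly (pderiv p) t - \<psi>' t\<bar> \<le> e"
proof -
  define d where "d = e / (1 + \<bar>K\<bar>)"
  have d: "0 < d" "d * \<bar>K\<bar> \<le> e" "d \<le> e"
    using \<open>0 < e\<close> by (auto simp: d_def field_simps)
  obtain g where g: "real_polynomial_function g" "\<And>t. t \<in> {-K..K} \<Longrightarrow> \<bar>\<psi>' t - g t\<bar> < d"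
    using Stone_Weierstrass_real_polynomial_function[of "{-K..K}" \<psi>' d] cont d(1)
    by (metis compact_Icc continuous_on_subset subset_UNIV)
  obtain p where p: "poly (pderiv p) = g" "poly p 0 = \<psi> 0"
    by (rule real_polynomial_function_antiderivative[OF g(1)])
  have pderiv_close: "\<bar>poly (pderiv p) t - \<psi>' t\<bar> \<le> d" if "\<bar>t\<bar> \<le> K" for t
    using g(2)[of t] that by (auto simp: p abs_le_iff abs_less_iff)
  have "\<bar>poly p t - \<psi> t\<bar> \<le> e" if t: "\<bar>t\<bar> \<le> K" for t
  proof -
    have "norm ((poly p t - \<psi> t) - (poly p 0 - \<psi> 0)) \<le> d * norm (t - 0)"
    proof (rule field_differentiable_bound[where S="{-K..K}" and f'="\<lambda>t. poly (pderiv p) t - \<psi>' t"])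
      show "((\<lambda>t. poly p t - \<psi> t) has_field_derivative poly (pderiv p) z - \<psi>' z)
          (at z within {-K..K})" for z
        by (intro DERIV_diff DERIV_subset[OF poly_DERIV] DERIV_subset[OF deriv]) auto
    qed (use pderiv_close t in auto)
    also have "\<dots> \<le> d * \<bar>K\<bar>" using t d(1) by (intro mult_left_mono) auto
    finally show ?thesis using d(2) by (simp add: p)
  qed
  moreover have "\<bar>poly (pderiv p) t - \<psi>' t\<bar> \<le> e" if "\<bar>t\<bar> \<le> K" for t
    using pderiv_close[OF that] d(3) by linarith
  ultimately show ?thesis by (rule that)
qed

lemma tendsto_compose_approx:
  fixes \<psi> :: "real \<Rightarrow> real"
  assumes "\<And>n t. \<bar>t\<bar> \<le> K \<Longrightarrow> \<bar>q n t - \<psi> t\<bar> \<le> e n" "e \<longlonglongrightarrow> 0"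
    and "continuous_on UNIV \<psi>" "\<And>n. \<bar>h n\<bar> \<le> K" "h \<longlonglongrightarrow> l"
  shows "(\<lambda>n. q n (h n)) \<longlonglongrightarrow> \<psi> l"
proof -
  have "(\<lambda>n. q n (h n) - \<psi> (h n)) \<longlonglongrightarrow> 0"
    by (rule Lim_null_comparison[OF always_eventually assms(2)]) (simp add: assms(1,4))
  moreover have "(\<lambda>n. \<psi> (h n)) \<longlonglongrightarrow> \<psi> l"
    by (rule continuous_on_tendsto_compose[OF assms(3,5)]) auto
  ultimately show ?thesis using tendsto_add by fastforce
qed

lemma decreasing_C1_poly_approx:
  fixes \<psi> \<psi>' :: "real \<Rightarrow> real"
  assumes deriv: "\<And>t. (\<psi> has_real_derivative \<psi>' t) (at t)" and cont: "continuous_on UNIV \<psi>'"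
    and neg: "\<And>t. \<psi>' t < 0" and "0 \<le> K"
  obtains p B d where "0 < d" "\<And>n t. \<bar>t\<bar> \<le> K \<Longrightarrow> \<bar>poly (p n) t\<bar> \<le> B"
    "\<And>n t. \<bar>t\<bar> \<le> K \<Longrightarrow> poly (pderiv (p n)) t \<le> - d"
    "\<And>h l. (\<And>n. \<bar>h n\<bar> \<le> K) \<Longrightarrow> h \<longlonglongrightarrow> l \<Longrightarrow> (\<lambda>n. poly (p n) (h n)) \<longlonglongrightarrow> \<psi> l"
    "\<And>h l. (\<And>n. \<bar>h n\<bar> \<le> K) \<Longrightarrow> h \<longlonglongrightarrow> l \<Longrightarrow> (\<lambda>n. poly (pderiv (p n)) (h n)) \<longlonglongrightarrow> \<psi>' l"
proof -
  have cont\<psi>: "continuous_on UNIV \<psi>"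
    by (rule has_real_derivative_imp_continuous_on[OF deriv])
  obtain B where B: "\<And>t. \<bar>t\<bar> \<le> K \<Longrightarrow> \<bar>\<psi> t\<bar> \<le> B"
    using continuous_imp_bounded_on_abs_le[OF cont\<psi>] by blast
  obtain z where "\<forall>t\<in>{-K..K}. \<psi>' t \<le> \<psi>' z"
    using continuous_attains_sup[OF compact_Icc _ continuous_on_subset[OF cont subset_UNIV], of "- K" K]
      \<open>0 \<le> K\<close> by auto
  then have z: "\<psi>' t \<le> \<psi>' z" if "\<bar>t\<bar> \<le> K" for t
    using that by (simp add: abs_le_iff minus_le_iff)
  define d where "d = - \<psi>' z / 2"
  have d: "0 < d" using neg by (simp add: d_def)
  define e where "e n = d * inverse (real (Suc n))" for n
  have e: "0 < e n" "e n \<le> d" for n using d by (auto simp: e_def field_simps)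
  have "e \<longlonglongrightarrow> d * 0"
    unfolding e_def by (intro tendsto_mult tendsto_const LIMSEQ_inverse_real_of_nat)
  then have e_lim: "e \<longlonglongrightarrow> 0" by simp
  have "\<exists>p. \<forall>t. \<bar>t\<bar> \<le> K \<longrightarrow> \<bar>poly p t - \<psi> t\<bar> \<le> e n \<and> \<bar>poly (pderiv p) t - \<psi>' t\<bar> \<le> e n" for n
    by (rule C1_poly_approx[OF deriv cont e(1)[of n], of K]) auto
  then obtain p where p: "\<And>n t. \<bar>t\<bar> \<le> K \<Longrightarrow> \<bar>poly (p n) t - \<psi> t\<bar> \<le> e n"
      "\<And>n t. \<bar>t\<bar> \<le> K \<Longrightarrow> \<bar>poly (pderiv (p n)) t - \<psi>' t\<bar> \<le> e n"
    by metis
  show ?thesis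
  proof (rule that[OF d])
    show "\<bar>poly (p n) t\<bar> \<le> B + d" if "\<bar>t\<bar> \<le> K" for n t
      using p(1)[OF that, of n] B[OF that] e(2)[of n] by linarith
    show "poly (pderiv (p n)) t \<le> - d" if "\<bar>t\<bar> \<le> K" for n t
      using p(2)[OF that, of n] z[OF that] e(2)[of n] unfolding d_def by linarith
  qed (auto intro: tendsto_compose_approx[OF _ e_lim] p cont\<psi> cont)
qed

lemma deriv_poly: "deriv (poly p) = poly (pderiv p)" for p :: "real poly"
  by (rule ext, rule DERIV_imp_deriv, rule poly_DERIV)

lemma smooth_real_poly: "smooth_real (poly p)"
proof -
  have "(deriv ^^ k) (poly p) = poly ((pderiv ^^ k) p)" for k
    by (induction k) (simp_all add: deriv_poly)
  then show ?thesis
    unfolding smooth_real_def using real_differentiable_def poly_DERIV by metis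
qed

section \<open>Integration\<close>

lemma borel_measurable_compose_Ici:
  fixes g :: "real \<Rightarrow> real"
  assumes "continuous_on {a..} g" "W \<in> borel_measurable M" "\<And>x. a \<le> W x"
  shows "(\<lambda>x. g (W x)) \<in> borel_measurable M"
  by (rule measurable_compose[OF measurable_restrict_space2[of W M "{a..}" borel]
        borel_measurable_continuous_on_restrict[OF assms(1)]]) (use assms in auto)

lemma integrable_bounded_mult:
  fixes u g :: "'a \<Rightarrow> real"
  assumes "integrable M u" "g \<in> borel_measurable M" "AE x in M. \<bar>g x\<bar> \<le> K"
  shows "integrable M (\<lambda>x. g x * u x)"
proof (rule Bochner_Integration.integrable_bound)
  show "integrable M (\<lambda>x. K * u x)" using assms(1) by simp
  show "(\<lambda>x. g x * u x) \<in> borel_measurable M" using assms(1,2) by simp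
  show "AE x in M. norm (g x * u x) \<le> norm (K * u x)"
    using assms(3) by eventually_elim (auto simp: abs_mult intro!: mult_right_mono)
qed

lemma integrable_L1_limit:
  fixes U :: "nat \<Rightarrow> 'a \<Rightarrow> real"
  assumes U: "\<And>k. integrable M (U k)" and u: "u \<in> borel_measurable M"
    and lim: "(\<lambda>k. \<integral>\<^sup>+ x. ennreal \<bar>U k x - u x\<bar> \<partial>M) \<longlonglongrightarrow> 0"
  shows "integrable M u"
proof -
  note [measurable] = borel_measurable_integrable[OF U] u
  obtain k where "(\<integral>\<^sup>+ x. ennreal \<bar>U k x - u x\<bar> \<partial>M) < 1"
    using eventually_happens[OF order_tendstoD(2)[OF lim, of 1]] by auto
  then have "integrable M (\<lambda>x. U k x - u x)"
    by (intro integrableI_bounded) (auto intro: less_trans)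
  from Bochner_Integration.integrable_diff[OF U[of k] this] show ?thesis by simp
qed

lemma AE_abs_le_of_tendsto:
  fixes a :: "nat \<Rightarrow> 'a \<Rightarrow> real"
  assumes "\<And>k. AE x in M. \<bar>a k x\<bar> \<le> B" "AE x in M. (\<lambda>k. a k x) \<longlonglongrightarrow> \<alpha> x"
  shows "AE x in M. \<bar>\<alpha> x\<bar> \<le> B"
proof -
  have "AE x in M. \<forall>k. \<bar>a k x\<bar> \<le> B" using assms(1) by (simp add: AE_all_countable)
  with assms(2) show ?thesis
    by eventually_elim (rule tendsto_upperbound[OF tendsto_rabs], auto)
qed

lemma nn_integral_bounded_diff_mult_tendsto_0:
  fixes a :: "nat \<Rightarrow> 'a \<Rightarrow> real"
  assumes u: "integrable M u"
    and [measurable]: "\<And>k. a k \<in> borel_measurable M" "\<alpha> \<in> borel_measurable M"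
    and a_bound: "\<And>k. AE x in M. \<bar>a k x\<bar> \<le> B"
    and a_lim: "AE x in M. (\<lambda>k. a k x) \<longlonglongrightarrow> \<alpha> x"
  shows "(\<lambda>k. \<integral>\<^sup>+ x. ennreal \<bar>(a k x - \<alpha> x) * u x\<bar> \<partial>M) \<longlonglongrightarrow> 0"
proof -
  note [measurable] = borel_measurable_integrable[OF u]
  have "(\<lambda>k. \<integral>\<^sup>+ x. ennreal \<bar>(a k x - \<alpha> x) * u x\<bar> \<partial>M) \<longlonglongrightarrow> (\<integral>\<^sup>+ x. 0 \<partial>M)"
  proof (rule nn_integral_dominated_convergence)
    show "AE x in M. ennreal \<bar>(a k x - \<alpha> x) * u x\<bar> \<le> ennreal (norm (2 * B * u x))" for k
      using a_bound[of k] AE_abs_le_of_tendsto[OF a_bound a_lim]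
      by eventually_elim (auto simp: abs_mult intro!: ennreal_leI mult_right_mono)
    show "(\<integral>\<^sup>+ x. ennreal (norm (2 * B * u x)) \<partial>M) < \<infinity>"
      using u by (intro integrable_iff_bounded[THEN iffD1, THEN conjunct2]) simp
    show "AE x in M. (\<lambda>k. ennreal \<bar>(a k x - \<alpha> x) * u x\<bar>) \<longlonglongrightarrow> 0"
      using a_lim
    proof eventually_elim
      case (elim x)
      have "(\<lambda>k. \<bar>(a k x - \<alpha> x) * u x\<bar>) \<longlonglongrightarrow> \<bar>(\<alpha> x - \<alpha> x) * u x\<bar>"
        by (intro tendsto_intros elim)
      then show ?case by (simp add: tendsto_ennreal_iff flip: ennreal_0)
    qed
  qed measurable
  then show ?thesis by simp
qed

lemma tendsto_integral_bounded_mult_L1: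
  fixes a U :: "nat \<Rightarrow> 'a \<Rightarrow> real"
  assumes U: "\<And>k. integrable M (U k)" and u: "u \<in> borel_measurable M"
    and U_lim: "(\<lambda>k. \<integral>\<^sup>+ x. ennreal \<bar>U k x - u x\<bar> \<partial>M) \<longlonglongrightarrow> 0"
    and a: "\<And>k. a k \<in> borel_measurable M" "\<alpha> \<in> borel_measurable M"
    and a_bound: "\<And>k. AE x in M. \<bar>a k x\<bar> \<le> B"
    and a_lim: "AE x in M. (\<lambda>k. a k x) \<longlonglongrightarrow> \<alpha> x"
  shows "integrable M (\<lambda>x. \<alpha> x * u x)"
    and "(\<lambda>k. \<integral>x. a k x * U k x \<partial>M) \<longlonglongrightarrow> (\<integral>x. \<alpha> x * u x \<partial>M)"
proof -
  note [measurable] = a u borel_measurable_integrable[OF U]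
  have u_int: "integrable M u" by (rule integrable_L1_limit[OF U u U_lim])
  show \<alpha>u: "integrable M (\<lambda>x. \<alpha> x * u x)"
    by (rule integrable_bounded_mult[OF u_int a(2) AE_abs_le_of_tendsto[OF a_bound a_lim]])
  have split: "AE x in M. ennreal (norm (a k x * U k x - \<alpha> x * u x))
      \<le> ennreal B * ennreal \<bar>U k x - u x\<bar> + ennreal \<bar>(a k x - \<alpha> x) * u x\<bar>" for k
    using a_bound[of k]
  proof eventually_elim
    case (elim x)
    have "\<bar>a k x * U k x - \<alpha> x * u x\<bar> = \<bar>a k x * (U k x - u x) + (a k x - \<alpha> x) * u x\<bar>"
      by (simp add: algebra_simps)
    also have "\<dots> \<le> \<bar>a k x\<bar> * \<bar>U k x - u x\<bar> + \<bar>(a k x - \<alpha> x) * u x\<bar>"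
      by (rule order_trans[OF abs_triangle_ineq]) (simp add: abs_mult)
    also have "\<dots> \<le> B * \<bar>U k x - u x\<bar> + \<bar>(a k x - \<alpha> x) * u x\<bar>"
      by (intro add_right_mono mult_right_mono elim) simp
    finally show ?case
      using elim by (simp add: ennreal_leI flip: ennreal_mult' ennreal_plus)
  qed
  have bound: "(\<integral>\<^sup>+ x. ennreal (norm (a k x * U k x - \<alpha> x * u x)) \<partial>M)
      \<le> ennreal B * (\<integral>\<^sup>+ x. ennreal \<bar>U k x - u x\<bar> \<partial>M)
        + (\<integral>\<^sup>+ x. ennreal \<bar>(a k x - \<alpha> x) * u x\<bar> \<partial>M)" for k
    using nn_integral_mono_AE[OF split[of k]] by (simp add: nn_integral_add nn_integral_cmult)
  have "(\<lambda>k. ennreal B * (\<integral>\<^sup>+ x. ennreal \<bar>U k x - u x\<bar> \<partial>M)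
      + (\<integral>\<^sup>+ x. ennreal \<bar>(a k x - \<alpha> x) * u x\<bar> \<partial>M)) \<longlonglongrightarrow> ennreal B * 0 + 0"
    by (intro tendsto_add ennreal_tendsto_cmult U_lim
        nn_integral_bounded_diff_mult_tendsto_0[OF u_int a a_bound a_lim]) simp
  then have "(\<lambda>k. ennreal B * (\<integral>\<^sup>+ x. ennreal \<bar>U k x - u x\<bar> \<partial>M)
      + (\<integral>\<^sup>+ x. ennreal \<bar>(a k x - \<alpha> x) * u x\<bar> \<partial>M)) \<longlonglongrightarrow> 0" by simp
  from tendsto_sandwich[OF _ _ tendsto_const this]
  have "(\<lambda>k. \<integral>\<^sup>+ x. ennreal (norm (a k x * U k x - \<alpha> x * u x)) \<partial>M) \<longlonglongrightarrow> 0"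
    using bound by simp
  then show "(\<lambda>k. \<integral>x. a k x * U k x \<partial>M) \<longlonglongrightarrow> (\<integral>x. \<alpha> x * u x \<partial>M)"
    by (intro tendsto_L1_int integrable_bounded_mult[OF U _ a_bound] \<alpha>u) auto
qed

lemma tendsto_integral_square_divide_mult:
  fixes a c :: "nat \<Rightarrow> 'a \<Rightarrow> real"
  assumes g: "integrable M g" "AE x in M. 0 \<le> g x"
    and [measurable]: "\<And>n. a n \<in> borel_measurable M" "\<And>n. c n \<in> borel_measurable M"
      "\<alpha> \<in> borel_measurable M" "\<gamma> \<in> borel_measurable M"
    and bound: "\<And>n x. \<bar>a n x\<bar> \<le> B" "0 < d" "\<And>n x. d \<le> c n x"
    and lim: "AE x in M. (\<lambda>n. a n x) \<longlonglongrightarrow> \<alpha> x" "AE x in M. (\<lambda>n. c n x) \<longlonglongrightarrow> \<gamma> x"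
    and \<gamma>: "\<And>x. \<gamma> x \<noteq> 0"
  shows "(\<lambda>n. \<integral>x. (a n x)\<^sup>2 / c n x * g x \<partial>M) \<longlonglongrightarrow> (\<integral>x. (\<alpha> x)\<^sup>2 / \<gamma> x * g x \<partial>M)"
proof (rule integral_dominated_convergence)
  note [measurable] = borel_measurable_integrable[OF g(1)]
  show "(\<lambda>x. (\<alpha> x)\<^sup>2 / \<gamma> x * g x) \<in> borel_measurable M"
    and "(\<lambda>x. (a n x)\<^sup>2 / c n x * g x) \<in> borel_measurable M" for n
    by measurable
  show "integrable M (\<lambda>x. B\<^sup>2 / d * g x)" by (rule integrable_mult_right[OF g(1)])
  show "AE x in M. (\<lambda>n. (a n x)\<^sup>2 / c n x * g x) \<longlonglongrightarrow> (\<alpha> x)\<^sup>2 / \<gamma> x * g x"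
    using lim by eventually_elim (intro tendsto_intros \<gamma>)
  show "AE x in M. norm ((a n x)\<^sup>2 / c n x * g x) \<le> B\<^sup>2 / d * g x" for n
    using g(2)
  proof eventually_elim
    case (elim x)
    from mult_right_mono[OF abs_square_divide_le[OF bound(1,2,3)] elim] elim
    show ?case by (simp add: abs_mult)
  qed
qed

lemma fatou_integral_le:
  fixes G :: "nat \<Rightarrow> 'a \<Rightarrow> real"
  assumes G: "\<And>n. integrable M (G n)" "\<And>n. AE x in M. 0 \<le> G n x"
    and g: "g \<in> borel_measurable M" and lim: "AE x in M. (\<lambda>n. G n x) \<longlonglongrightarrow> g x"
    and bound: "\<And>n. (\<integral>x. G n x \<partial>M) \<le> c n" and c: "c \<longlonglongrightarrow> C"
  shows "integrable M g" and "(\<integral>x. g x \<partial>M) \<le> C"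
proof -
  note [measurable] = g borel_measurable_integrable[OF G(1)]
  have "AE x in M. \<forall>n. 0 \<le> G n x" using G(2) by (simp add: AE_all_countable)
  then have g0: "AE x in M. 0 \<le> g x"
    using lim by eventually_elim (rule LIMSEQ_le_const, auto)
  have "(\<integral>\<^sup>+ x. ennreal (g x) \<partial>M) = (\<integral>\<^sup>+ x. liminf (\<lambda>n. ennreal (G n x)) \<partial>M)"
    by (rule nn_integral_cong_AE, use lim in eventually_elim)
      (intro lim_imp_Liminf[symmetric] tendsto_ennrealI, auto)
  also have "\<dots> \<le> liminf (\<lambda>n. \<integral>\<^sup>+ x. ennreal (G n x) \<partial>M)"
    by (rule nn_integral_liminf) measurable
  also have "\<dots> \<le> liminf (\<lambda>n. ennreal (c n))"
    by (intro Liminf_mono always_eventually allI)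
      (simp add: nn_integral_eq_integral G ennreal_leI bound)
  also have "\<dots> = ennreal C"
    by (intro lim_imp_Liminf tendsto_ennrealI c) simp
  finally have le: "(\<integral>\<^sup>+ x. ennreal (g x) \<partial>M) \<le> ennreal C" .
  show int: "integrable M g"
    by (rule integrableI_nonneg[OF g g0]) (use le in \<open>auto intro: le_less_trans\<close>)
  have "0 \<le> C"
    by (rule LIMSEQ_le_const[OF c]) (use bound integral_nonneg_AE[OF G(2)] order_trans in blast)
  with le show "(\<integral>x. g x \<partial>M) \<le> C"
    by (simp add: nn_integral_eq_integral int g0)
qed

lemma ennreal_divide_add_le:
  fixes x k e :: real
  assumes "0 \<le> x" "0 \<le> k" "0 < e"
  shows "ennreal (x / (k + e)) \<le> 1 / ennreal k * ennreal x"
proof (cases "k = 0")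
  case True
  then show ?thesis using assms by (cases "x = 0") (auto simp: ennreal_top_mult)
next
  case False
  then have "1 / ennreal k * ennreal x = ennreal (x / k)"
    using assms by (simp add: divide_ennreal flip: ennreal_1 ennreal_mult')
  then show ?thesis using assms False by (auto intro!: ennreal_leI divide_left_mono)
qed

section \<open>Variance, oscillation and quantiles\<close>

lemma (in real_distribution) quantile_inv_measure_lessThan:
  assumes zero: "cdf M 0 = 0" and s: "0 < s" "s < 1"
  defines "q \<equiv> quantile_inv (\<lambda>u. measure M {..<u}) s"
  shows "0 < q" and "measure M {..<q} \<le> s"
proof -
  have less_le_cdf: "measure M {..<u} \<le> cdf M u" for u
    unfolding cdf_def by (intro finite_measure_mono) auto
  have cdf_le_less: "cdf M u \<le> measure M {..<v}" if "u < v" for u v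
    unfolding cdf_def using that by (intro finite_measure_mono) auto
  have "(cdf M \<longlongrightarrow> 0) (at_right 0)"
    using cdf_is_right_cont[of 0] zero by (simp add: continuous_within)
  from eventually_conj[OF order_tendstoD(2)[OF this s(1)] eventually_at_right_less]
  obtain a where a: "0 < a" "cdf M a < s"
    by (auto dest!: eventually_happens)
  have lower: "a \<le> u" if "s < measure M {..<u}" for u
    using that a(2) less_le_cdf[of u] cdf_nondecreasing[of u a] by linarith
  have "\<forall>\<^sub>F u in at_top. s < cdf M u"
    by (rule order_tendstoD(1)[OF cdf_lim_at_top_prob s(2)])
  then obtain u where "s < cdf M u" using eventually_happens by fastforce
  then have "s < measure M {..<u + 1}" using cdf_le_less[of u "u + 1"] by simp
  then have "a \<le> q"
    unfolding q_def quantile_inv_def by (intro cInf_greatest) (auto intro: lower)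
  with a(1) show "0 < q" by simp
  have below: "measure M {..<u} \<le> s" if "u < q" for u
  proof (rule ccontr)
    assume "\<not> measure M {..<u} \<le> s"
    then have "q \<le> u"
      unfolding q_def quantile_inv_def using lower by (intro cInf_lower bdd_belowI) auto
    with that show False by simp
  qed
  have "cdf M u \<le> s" if "u < q" for u
  proof -
    obtain v where "u < v" "v < q" using dense[OF \<open>u < q\<close>] by blast
    then show ?thesis using cdf_le_less[of u v] below[of v] by linarith
  qed
  then show "measure M {..<q} \<le> s"
    by (intro tendsto_upperbound[OF cdf_at_left]) (auto simp: eventually_at_filter)
qed

context prob_space
begin

lemma Var_le_integral_square_diff:
  assumes f: "integrable M f" "integrable M (\<lambda>x. (f x)\<^sup>2)"
  shows "Var M f \<le> (\<integral>x. (f x - c)\<^sup>2 \<partial>M)"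
proof -
  have "(\<integral>x. (f x - c)\<^sup>2 \<partial>M) = (\<integral>x. (f x)\<^sup>2 - 2 * c * f x + c\<^sup>2 \<partial>M)"
    by (simp add: power2_diff algebra_simps)
  also have "\<dots> = (\<integral>x. (f x)\<^sup>2 \<partial>M) - 2 * c * (\<integral>x. f x \<partial>M) + c\<^sup>2"
    using f by (simp add: prob_space)
  finally have "(\<integral>x. (f x - c)\<^sup>2 \<partial>M) = Var M f + ((\<integral>x. f x \<partial>M) - c)\<^sup>2"
    by (simp add: Var_def power2_diff algebra_simps)
  then show ?thesis by simp
qed

lemma esssup_bounded:
  fixes f :: "'a \<Rightarrow> real"
  assumes [measurable]: "f \<in> borel_measurable M" and K: "\<And>x. \<bar>f x\<bar> \<le> K"
  obtains u where "esssup M (\<lambda>x. ereal (f x)) = ereal u" "AE x in M. f x \<le> u"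
proof -
  have "esssup M (\<lambda>x. ereal (f x)) \<le> ereal K"
    using K by (intro esssup_I) (auto simp: abs_le_iff)
  moreover have "ereal (- K) \<le> esssup M (\<lambda>x. ereal (f x))"
  proof -
    have "esssup M (\<lambda>x. ereal (- K)) \<le> esssup M (\<lambda>x. ereal (f x))"
      by (rule esssup_mono) (use K in \<open>auto simp: abs_le_iff intro: minus_le_iff[THEN iffD1]\<close>)
    then show ?thesis by (simp add: esssup_const emeasure_space_1)
  qed
  ultimately obtain u where u: "esssup M (\<lambda>x. ereal (f x)) = ereal u"
    by (cases "esssup M (\<lambda>x. ereal (f x))") auto
  have "AE x in M. f x \<le> u"
    using esssup_AE[of "\<lambda>x. ereal (f x)" M] unfolding u by simp
  with u show ?thesis by (rule that)
qed

lemma Osc_bounded: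
  fixes f :: "'a \<Rightarrow> real"
  assumes f[measurable]: "f \<in> borel_measurable M" and K: "\<And>x. \<bar>f x\<bar> \<le> K"
  obtains l u where "Osc M f = u - l" "AE x in M. l \<le> f x" "AE x in M. f x \<le> u"
proof -
  obtain u where u: "esssup M (\<lambda>x. ereal (f x)) = ereal u" "AE x in M. f x \<le> u"
    using esssup_bounded[OF f K] by blast
  obtain l where l: "esssup M (\<lambda>x. ereal (- f x)) = ereal l" "AE x in M. - f x \<le> l"
    using esssup_bounded[of "\<lambda>x. - f x" K] K by auto
  have "Osc M f = u - (- l)"
    unfolding Osc_def essinf_def using u l by simp
  moreover have "AE x in M. - l \<le> f x" using l(2) by eventually_elim simp
  ultimately show ?thesis using u(2) by (rule that)
qed

text \<open>
  On a null set the quotient is the junk value $x/0 = 0$, which may lie outside the range of \<open>f\<close>.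
\<close>

definition local_mean :: "'a set \<Rightarrow> ('a \<Rightarrow> real) \<Rightarrow> real"
  where "local_mean B f = (if prob B = 0 then expectation f else (LINT x:B|M. f x) / prob B)"

lemma set_integrable_real:
  fixes f :: "'a \<Rightarrow> real"
  shows "B \<in> sets M \<Longrightarrow> integrable M f \<Longrightarrow> set_integrable M B f"
  unfolding set_integrable_def by (rule integrable_mult_indicator)

lemma set_integral_const_real: "B \<in> sets M \<Longrightarrow> (LINT x:B|M. c) = c * prob B" for c :: real
  by (simp add: set_lebesgue_integral_def)

lemma set_integral_diff_local_mean:
  assumes "B \<in> sets M" "integrable M f" "prob B \<noteq> 0"
  shows "(LINT x:B|M. f x - local_mean B f) = 0"
  using assms
  by (simp add: set_integral_diff set_integrable_real set_integral_const_real local_mean_def)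

lemma local_mean_le:
  assumes B: "B \<in> sets M" and f: "integrable M f" and u: "AE x in M. f x \<le> u"
  shows "local_mean B f \<le> u"
proof (cases "prob B = 0")
  case True
  then show ?thesis using integral_le_const[OF f u] by (simp add: local_mean_def)
next
  case False
  then have "0 < prob B" by (simp add: zero_less_measure_iff)
  moreover have "(LINT x:B|M. f x) \<le> (LINT x:B|M. u)"
    by (intro set_integral_mono_AE set_integrable_real B f) (use u in auto)
  ultimately show ?thesis
    using B by (simp add: local_mean_def set_integral_const_real divide_le_eq)
qed

lemma local_mean_uminus: "local_mean B (\<lambda>x. - f x) = - local_mean B f"
  by (simp add: local_mean_def set_lebesgue_integral_def)

lemma AE_abs_diff_local_mean_le_Osc:
  assumes f: "f \<in> borel_measurable M" "\<And>x. \<bar>f x\<bar> \<le> K" and B: "B \<in> sets M"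
  shows "AE x in M. \<bar>f x - local_mean B f\<bar> \<le> Osc M f"
proof -
  have int: "integrable M f"
    using f by (intro integrable_const_bound[where B=K]) auto
  obtain l u where Osc: "Osc M f = u - l" and l: "AE x in M. l \<le> f x" and u: "AE x in M. f x \<le> u"
    by (rule Osc_bounded[OF f])
  have upper: "local_mean B f \<le> u" by (rule local_mean_le[OF B int u])
  have lower: "l \<le> local_mean B f"
    using local_mean_le[OF B, of "\<lambda>x. - f x" "- l"] int l by (simp add: local_mean_uminus)
  from l u show ?thesis
    by eventually_elim (use upper lower Osc in \<open>simp add: abs_le_iff\<close>)
qed

lemma quantile_inv_prob_less:
  assumes r[measurable]: "r \<in> borel_measurable M" and r_pos: "\<And>x. 0 < r x" and s: "0 < s" "s < 1"
  defines "q \<equiv> quantile_inv (\<lambda>u. prob {x \<in> space M. r x < u}) s"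
  shows "0 < q" and "prob {x \<in> space M. r x < q} \<le> s"
proof -
  interpret R: real_distribution "distr M borel r" by (rule real_distribution_distr[OF r])
  have prob_eq: "prob {x \<in> space M. r x < u} = measure (distr M borel r) {..<u}" for u
    by (auto simp: measure_distr intro!: arg_cong[where f=prob])
  have "\<not> r x \<le> 0" for x using r_pos[of x] by simp
  then have "r -` {..0} = {}" by auto
  then have "cdf (distr M borel r) 0 = 0" by (simp add: cdf_def measure_distr)
  from R.quantile_inv_measure_lessThan[OF this s]
  show "0 < q" and "prob {x \<in> space M. r x < q} \<le> s"
    by (simp_all add: q_def prob_eq)
qed

lemma integral_le_weighted_add_prob_less:
  assumes g: "integrable M g" "\<And>x. 0 \<le> g x" "AE x in M. g x \<le> K"
    and r[measurable]: "r \<in> borel_measurable M" and r_pos: "\<And>x. 0 < r x"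
    and gr: "integrable M (\<lambda>x. g x * r x)" and u: "0 < u"
  shows "(\<integral>x. g x \<partial>M) \<le> (\<integral>x. g x * r x \<partial>M) / u + K * prob {x \<in> space M. r x < u}"
proof -
  define S where "S = {x \<in> space M. r x < u}"
  have S[measurable]: "S \<in> sets M" unfolding S_def by measurable
  have S_int: "integrable M (\<lambda>x. K * indicator S x)"
    by (intro integrable_mult_right integrable_real_indicator S) (simp add: emeasure_eq_measure)
  have "(\<integral>x. g x \<partial>M) \<le> (\<integral>x. g x * r x / u + K * indicator S x \<partial>M)"
  proof (rule integral_mono_AE[OF g(1)])
    show "AE x in M. g x \<le> g x * r x / u + K * indicator S x"
      using g(3) AE_space
    proof eventually_elim
      case (elim x)
      show ?case
      proof (cases "x \<in> S")
        case True
        have "0 \<le> g x * r x / u" using g(2)[of x] r_pos[of x] u by simp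
        then show ?thesis using True elim by simp
      next
        case False
        then have "g x * u \<le> g x * r x"
          using g(2)[of x] elim by (intro mult_left_mono) (auto simp: S_def)
        then show ?thesis using False u by (simp add: le_divide_eq)
      qed
    qed
  qed (use gr S_int in auto)
  also have "\<dots> = (\<integral>x. g x * r x \<partial>M) / u + K * prob S"
    using gr S_int by simp
  finally show ?thesis by (simp add: S_def)
qed

end

section \<open>Calculus of the carre du champ\<close>

context symmetric_diffusion
begin

abbreviation \<Gamma> :: "(real ^ 'n \<Rightarrow> real) \<Rightarrow> (real ^ 'n \<Rightarrow> real) \<Rightarrow> real ^ 'n \<Rightarrow> real"
  where "\<Gamma> \<equiv> carre_du_champ L"

abbreviation energy :: "(real ^ 'n \<Rightarrow> real) \<Rightarrow> real"
  where "energy f \<equiv> \<integral>x. \<Gamma> f f x \<partial>\<mu>"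

lemma space_UNIV: "space \<mu> = UNIV"
  using sets_eq_imp_space_eq[OF sets_eq_borel] by simp

lemma alg_dom: "f \<in> \<A> \<Longrightarrow> f \<in> D"
  using alg_subset by blast

lemma alg_scale: "f \<in> \<A> \<Longrightarrow> (\<lambda>x. c * f x) \<in> \<A>"
  by (rule alg_mult[OF alg_const])

lemma alg_diff_const: "f \<in> \<A> \<Longrightarrow> (\<lambda>x. f x - c) \<in> \<A>"
  using alg_add[OF _ alg_const, of f "- c"] by simp

lemma alg_square: "f \<in> \<A> \<Longrightarrow> (\<lambda>x. (f x)\<^sup>2) \<in> \<A>"
  using alg_mult[of f f] by (simp add: power2_eq_square)

lemma alg_poly: "f \<in> \<A> \<Longrightarrow> (\<lambda>x. poly p (f x)) \<in> \<A>"
  by (rule alg_smooth[OF _ smooth_real_poly])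

lemma alg_measurable: "f \<in> \<A> \<Longrightarrow> f \<in> borel_measurable \<mu>"
  by (simp add: alg_dom dom_measurable)

lemma L_integrable: "f \<in> \<A> \<Longrightarrow> integrable \<mu> (L f)"
  by (rule square_integrable_imp_integrable[OF L_measurable L_L2]) (auto intro: alg_dom)

lemma alg_mult_integrable:
  assumes "f \<in> \<A>" "integrable \<mu> u" shows "integrable \<mu> (\<lambda>x. f x * u x)"
proof -
  obtain K where "\<And>x. \<bar>f x\<bar> \<le> K" using alg_bounded[OF assms(1)] by blast
  then show ?thesis
    by (intro integrable_bounded_mult[OF assms(2) alg_measurable[OF assms(1)], of K]) simp
qed

lemma alg_integrable: "f \<in> \<A> \<Longrightarrow> integrable \<mu> f"
  using alg_mult_integrable[of f "\<lambda>_. 1"] by simp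

lemma gamma_integrable:
  assumes "f \<in> \<A>" "g \<in> \<A>" shows "integrable \<mu> (\<Gamma> f g)"
  unfolding carre_du_champ_def[abs_def]
  by (intro integrable_divide_zero Bochner_Integration.integrable_diff alg_mult_integrable L_integrable
      alg_mult assms)

lemma gamma_measurable: "f \<in> \<A> \<Longrightarrow> g \<in> \<A> \<Longrightarrow> \<Gamma> f g \<in> borel_measurable \<mu>"
  by (rule borel_measurable_integrable[OF gamma_integrable])

lemma gamma_commute: "\<Gamma> f g x = \<Gamma> g f x"
  by (simp add: carre_du_champ_def mult.commute)

lemma energy_nonneg: "f \<in> \<A> \<Longrightarrow> 0 \<le> energy f"
  by (intro integral_nonneg_AE gamma_nonneg)

lemma gamma_diff_const:
  assumes "f \<in> \<A>" shows "AE x in \<mu>. \<Gamma> (\<lambda>y. f y - c) (\<lambda>y. f y - c) x = \<Gamma> f f x"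
proof -
  have "(\<lambda>y. f y - c) = (\<lambda>y. poly [:- c, 1:] (f y))" by simp
  then show ?thesis
    using gamma_chain[OF assms assms, of "poly [:- c, 1:]" "poly [:- c, 1:]"] smooth_real_poly
    by (simp add: deriv_poly pderiv_pCons)
qed

lemma energy_diff_const: "f \<in> \<A> \<Longrightarrow> energy (\<lambda>x. f x - c) = energy f"
  by (intro integral_cong_AE gamma_measurable alg_diff_const gamma_diff_const)

lemma gamma_linear_left:
  assumes "f \<in> \<A>" "g \<in> \<A>" "h \<in> \<A>"
  shows "AE x in \<mu>. \<Gamma> (\<lambda>y. f y + q * g y) h x = \<Gamma> f h x + q * \<Gamma> g h x"
proof -
  have "AE x in \<mu>. L (\<lambda>y. f y + q * g y) x = L f x + q * L g x" if "f \<in> \<A>" "g \<in> \<A>" for f g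
    using L_add[OF alg_dom[OF that(1)] alg_dom[OF alg_scale[OF that(2), of q]]]
      L_scale[OF alg_dom[OF that(2)], of q]
    by eventually_elim simp
  from this[OF assms(1,2)] this[OF alg_mult[OF assms(1,3)] alg_mult[OF assms(2,3)]]
  show ?thesis
  proof eventually_elim
    case (elim x)
    have "L (\<lambda>y. (f y + q * g y) * h y) x = L (\<lambda>y. f y * h y) x + q * L (\<lambda>y. g y * h y) x"
      using elim(2) by (simp add: algebra_simps)
    then show ?case using elim(1) by (simp add: carre_du_champ_def field_simps)
  qed
qed

lemma gamma_quadratic:
  assumes "f \<in> \<A>" "g \<in> \<A>"
  shows "AE x in \<mu>. \<Gamma> (\<lambda>y. f y + q * g y) (\<lambda>y. f y + q * g y) x
    = \<Gamma> f f x + 2 * q * \<Gamma> f g x + q\<^sup>2 * \<Gamma> g g x"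
  using gamma_linear_left[OF assms alg_add[OF assms(1) alg_scale[OF assms(2), of q]], of q]
    gamma_linear_left[OF assms assms(1), of q] gamma_linear_left[OF assms assms(2), of q]
  by eventually_elim
    (simp add: gamma_commute[of f "\<lambda>y. f y + q * g y"] gamma_commute[of g "\<lambda>y. f y + q * g y"]
      gamma_commute[of g f] power2_eq_square distrib_left)

lemma gamma_cauchy_schwarz:
  assumes "f \<in> \<A>" "g \<in> \<A>"
  shows "AE x in \<mu>. (\<Gamma> f g x)\<^sup>2 \<le> \<Gamma> f f x * \<Gamma> g g x"
proof -
  have "AE x in \<mu>. 0 \<le> \<Gamma> f f x + 2 * q * \<Gamma> f g x + q\<^sup>2 * \<Gamma> g g x" for q
    using gamma_quadratic[OF assms, of q]
      gamma_nonneg[OF alg_add[OF assms(1) alg_scale[OF assms(2)]], of q]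
    by eventually_elim simp
  then have "AE x in \<mu>. \<forall>q\<in>\<rat>. 0 \<le> \<Gamma> f f x + 2 * q * \<Gamma> f g x + q\<^sup>2 * \<Gamma> g g x"
    by (simp add: AE_ball_countable countable_rat)
  then show ?thesis
  proof eventually_elim
    case (elim x)
    have "0 \<le> \<Gamma> f f x + 2 * q * \<Gamma> f g x + q\<^sup>2 * \<Gamma> g g x" for q
      by (rule continuous_ge_on_closure[where S="\<rat>"
            and f="\<lambda>q. \<Gamma> f f x + 2 * q * \<Gamma> f g x + q\<^sup>2 * \<Gamma> g g x"])
        (use elim in \<open>auto intro!: continuous_intros simp: Rats_closure_real\<close>)
    then show ?case by (rule square_le_mult_of_quadratic_nonneg)
  qed
qed

lemma L_one: "AE x in \<mu>. L (\<lambda>y. 1) x = 0"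
  using gamma_derivation[OF alg_const alg_const alg_const, of 1 1 1]
  by eventually_elim (simp add: carre_du_champ_def)

lemma integral_L_zero:
  assumes "f \<in> \<A>" shows "(\<integral>x. L f x \<partial>\<mu>) = 0"
proof -
  have "(\<integral>x. L f x \<partial>\<mu>) = (\<integral>x. f x * L (\<lambda>y. 1) x \<partial>\<mu>)"
    using L_symmetric[OF alg_dom[OF alg_const] alg_dom[OF assms], of 1] by simp
  also have "\<dots> = (\<integral>x. 0 \<partial>\<mu>)"
    by (rule integral_cong_AE)
      (use L_one alg_measurable[OF assms] L_measurable[OF alg_dom[OF alg_const]] in auto)
  finally show ?thesis by simp
qed

lemma integral_gamma:
  assumes "f \<in> \<A>" "g \<in> \<A>" shows "(\<integral>x. \<Gamma> f g x \<partial>\<mu>) = - (\<integral>x. f x * L g x \<partial>\<mu>)"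
proof -
  have "(\<integral>x. \<Gamma> f g x \<partial>\<mu>)
      = ((\<integral>x. L (\<lambda>y. f y * g y) x \<partial>\<mu>) - (\<integral>x. f x * L g x \<partial>\<mu>) - (\<integral>x. g x * L f x \<partial>\<mu>)) / 2"
    unfolding carre_du_champ_def
    by (simp add: Bochner_Integration.integral_diff alg_mult_integrable L_integrable alg_mult assms)
  then show ?thesis
    using L_symmetric[OF alg_dom[OF assms(1)] alg_dom[OF assms(2)]]
    by (simp add: integral_L_zero alg_mult assms)
qed

lemma gamma_square_mult_poly:
  assumes "f \<in> \<A>" "g \<in> \<A>"
  shows "AE x in \<mu>. \<Gamma> (\<lambda>y. (f y)\<^sup>2 * poly p (g y)) g x
    = 2 * f x * poly p (g x) * \<Gamma> f g x + (f x)\<^sup>2 * poly (pderiv p) (g x) * \<Gamma> g g x"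
proof -
  have "AE x in \<mu>. \<Gamma> (\<lambda>y. poly p (g y)) g x = poly (pderiv p) (g x) * \<Gamma> g g x"
    using gamma_chain[OF assms(2,2) smooth_real_poly smooth_real_poly, of p "[:0, 1:]"]
    by (simp add: deriv_poly pderiv_pCons)
  moreover have "AE x in \<mu>. \<Gamma> (\<lambda>y. (f y)\<^sup>2) g x = 2 * f x * \<Gamma> f g x"
    using gamma_derivation[OF assms(1,1,2)] by (simp add: power2_eq_square mult.assoc)
  ultimately show ?thesis
    using gamma_derivation[OF alg_square[OF assms(1)] alg_poly[OF assms(2)] assms(2), of p]
    by eventually_elim (simp add: algebra_simps)
qed

lemma gamma_square_mult_poly_le:
  assumes "f \<in> \<A>" "g \<in> \<A>" and decr: "\<And>x. poly (pderiv p) (g x) < 0"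
  shows "AE x in \<mu>. \<Gamma> (\<lambda>y. (f y)\<^sup>2 * poly p (g y)) g x
    \<le> (poly p (g x))\<^sup>2 / - poly (pderiv p) (g x) * \<Gamma> f f x"
  using gamma_square_mult_poly[OF assms(1,2), of p] gamma_cauchy_schwarz[OF assms(1,2)]
    gamma_nonneg[OF assms(1)] gamma_nonneg[OF assms(2)]
proof eventually_elim
  case (elim x)
  define d where "d = - poly (pderiv p) (g x)"
  have d: "0 < d" using decr by (simp add: d_def)
  have "2 * (f x * d) * poly p (g x) * \<Gamma> f g x \<le> (f x * d)\<^sup>2 * \<Gamma> g g x + (poly p (g x))\<^sup>2 * \<Gamma> f f x"
    by (rule two_mult_le_of_square_le_mult[OF elim(2-4)])
  then have "d * \<Gamma> (\<lambda>y. (f y)\<^sup>2 * poly p (g y)) g x \<le> (poly p (g x))\<^sup>2 * \<Gamma> f f x"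
    using elim(1) by (simp add: d_def power2_eq_square algebra_simps)
  then show ?case using d by (simp add: d_def[symmetric] field_simps)
qed

lemma integral_poly_mult_L_le:
  assumes f: "f \<in> \<A>" and g: "g \<in> \<A>" and d: "0 < d" and decr: "\<And>x. poly (pderiv p) (g x) \<le> - d"
  shows "- (\<integral>x. (f x)\<^sup>2 * poly p (g x) * L g x \<partial>\<mu>)
    \<le> (\<integral>x. (poly p (g x))\<^sup>2 / - poly (pderiv p) (g x) * \<Gamma> f f x \<partial>\<mu>)"
proof -
  have F: "(\<lambda>x. (f x)\<^sup>2 * poly p (g x)) \<in> \<A>"
    by (intro alg_mult alg_square alg_poly f g)
  have "- (\<integral>x. (f x)\<^sup>2 * poly p (g x) * L g x \<partial>\<mu>) = (\<integral>x. \<Gamma> (\<lambda>y. (f y)\<^sup>2 * poly p (g y)) g x \<partial>\<mu>)"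
    by (simp add: integral_gamma[OF F g])
  also have "\<dots> \<le> (\<integral>x. (poly p (g x))\<^sup>2 / - poly (pderiv p) (g x) * \<Gamma> f f x \<partial>\<mu>)"
  proof (rule integral_mono_AE[OF gamma_integrable[OF F g]])
    obtain P where P: "\<And>x. \<bar>poly p (g x)\<bar> \<le> P" using alg_bounded[OF alg_poly[OF g]] by blast
    note [measurable] = alg_measurable[OF alg_poly[OF g]]
    show "integrable \<mu> (\<lambda>x. (poly p (g x))\<^sup>2 / - poly (pderiv p) (g x) * \<Gamma> f f x)"
    proof (rule integrable_bounded_mult[OF gamma_integrable[OF f f] _ AE_I2])
      show "\<bar>(poly p (g x))\<^sup>2 / - poly (pderiv p) (g x)\<bar> \<le> P\<^sup>2 / d" for x
        using P d decr[of x] by (intro abs_square_divide_le) auto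
    qed measurable
    show "AE x in \<mu>. \<Gamma> (\<lambda>y. (f y)\<^sup>2 * poly p (g y)) g x
        \<le> (poly p (g x))\<^sup>2 / - poly (pderiv p) (g x) * \<Gamma> f f x"
      using d decr
      by (intro gamma_square_mult_poly_le f g) (meson le_less_trans neg_less_0_iff_less)
  qed
  finally show ?thesis .
qed

text \<open>The graph of \<open>L\<close> on \<open>\<A>\<close>, closed for the convergence that \<^const>\<open>smooth_enough\<close> refers to.\<close>

definition L_closure :: "(real ^ 'n \<Rightarrow> real) \<Rightarrow> (real ^ 'n \<Rightarrow> real) \<Rightarrow> bool"
  where "L_closure v u \<longleftrightarrow> v \<in> borel_measurable \<mu> \<and> u \<in> borel_measurable \<mu> \<and>
    (\<exists>h. (\<forall>k. h k \<in> \<A>) \<and> (\<exists>K. \<forall>k x. \<bar>h k x\<bar> \<le> K) \<and> (AE x in \<mu>. (\<lambda>k. h k x) \<longlonglongrightarrow> v x) \<and>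
      (\<lambda>k. \<integral>\<^sup>+ x. ennreal \<bar>L (h k) x - u x\<bar> \<partial>\<mu>) \<longlonglongrightarrow> 0)"

lemma L_closureE:
  assumes "L_closure v u"
  obtains h K where "v \<in> borel_measurable \<mu>" "u \<in> borel_measurable \<mu>"
    "\<And>k. h k \<in> \<A>" "\<And>k x. \<bar>h k x\<bar> \<le> K" "AE x in \<mu>. (\<lambda>k. h k x) \<longlonglongrightarrow> v x"
    "(\<lambda>k. \<integral>\<^sup>+ x. ennreal \<bar>L (h k) x - u x\<bar> \<partial>\<mu>) \<longlonglongrightarrow> 0"
  using assms unfolding L_closure_def by blast

lemma integral_decreasing_mult_L_closure_le:
  assumes f: "f \<in> \<A>" and vu: "L_closure v u"
    and deriv: "\<And>t. (\<psi> has_real_derivative \<psi>' t) (at t)" and cont: "continuous_on UNIV \<psi>'"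
    and neg: "\<And>t. \<psi>' t < 0"
  shows "integrable \<mu> (\<lambda>x. (f x)\<^sup>2 * \<psi> (v x) * u x)"
    and "- (\<integral>x. (f x)\<^sup>2 * \<psi> (v x) * u x \<partial>\<mu>) \<le> (\<integral>x. (\<psi> (v x))\<^sup>2 / - \<psi>' (v x) * \<Gamma> f f x \<partial>\<mu>)"
proof -
  obtain h K where meas[measurable]: "v \<in> borel_measurable \<mu>" "u \<in> borel_measurable \<mu>"
    and h: "\<And>k. h k \<in> \<A>" "\<And>k x. \<bar>h k x\<bar> \<le> K" "AE x in \<mu>. (\<lambda>k. h k x) \<longlonglongrightarrow> v x"
      "(\<lambda>k. \<integral>\<^sup>+ x. ennreal \<bar>L (h k) x - u x\<bar> \<partial>\<mu>) \<longlonglongrightarrow> 0"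
    by (rule L_closureE[OF vu]) blast
  have K: "0 \<le> K" using h(2)[of 0 undefined] by linarith
  obtain p B d where d: "0 < d" and p_bound: "\<And>n t. \<bar>t\<bar> \<le> K \<Longrightarrow> \<bar>poly (p n) t\<bar> \<le> B"
    and p'_bound: "\<And>n t. \<bar>t\<bar> \<le> K \<Longrightarrow> poly (pderiv (p n)) t \<le> - d"
    and p_lim: "\<And>h l. (\<And>n. \<bar>h n\<bar> \<le> K) \<Longrightarrow> h \<longlonglongrightarrow> l \<Longrightarrow> (\<lambda>n. poly (p n) (h n)) \<longlonglongrightarrow> \<psi> l"
    and p'_lim: "\<And>h l. (\<And>n. \<bar>h n\<bar> \<le> K) \<Longrightarrow> h \<longlonglongrightarrow> l \<Longrightarrow> (\<lambda>n. poly (pderiv (p n)) (h n)) \<longlonglongrightarrow> \<psi>' l"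
    by (rule decreasing_C1_poly_approx[OF deriv cont neg K]) blast
  note p_bound = p_bound[OF h(2)] and p'_bound = p'_bound[OF h(2)]
  have "continuous_on UNIV \<psi>"
    by (rule has_real_derivative_imp_continuous_on[OF deriv])
  note [measurable] = alg_measurable[OF f] alg_measurable[OF alg_poly[OF h(1)]]
    borel_measurable_continuous_on[OF this meas(1)] borel_measurable_continuous_on[OF cont meas(1)]
  obtain F where F: "\<And>x. \<bar>(f x)\<^sup>2\<bar> \<le> F" using alg_bounded[OF alg_square[OF f]] by blast
  have left_bound: "AE x in \<mu>. \<bar>(f x)\<^sup>2 * poly (p k) (h k x)\<bar> \<le> F * B" for k
    unfolding abs_mult by (intro AE_I2 mult_mono' F p_bound) auto
  have left_lim: "AE x in \<mu>. (\<lambda>k. (f x)\<^sup>2 * poly (p k) (h k x)) \<longlonglongrightarrow> (f x)\<^sup>2 * \<psi> (v x)"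
    using h(3) by eventually_elim (intro tendsto_intros p_lim h(2))
  note left = tendsto_integral_bounded_mult_L1
    [OF L_integrable[OF h(1)] meas(2) h(4) _ _ left_bound left_lim]
  show "integrable \<mu> (\<lambda>x. (f x)\<^sup>2 * \<psi> (v x) * u x)" by (rule left(1)) measurable
  have right: "(\<lambda>k. \<integral>x. (poly (p k) (h k x))\<^sup>2 / - poly (pderiv (p k)) (h k x) * \<Gamma> f f x \<partial>\<mu>)
      \<longlonglongrightarrow> (\<integral>x. (\<psi> (v x))\<^sup>2 / - \<psi>' (v x) * \<Gamma> f f x \<partial>\<mu>)"
  proof (rule tendsto_integral_square_divide_mult[OF gamma_integrable[OF f f] gamma_nonneg[OF f]])
    show "AE x in \<mu>. (\<lambda>k. poly (p k) (h k x)) \<longlonglongrightarrow> \<psi> (v x)"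
      using h(3) by eventually_elim (intro p_lim h(2))
    show "AE x in \<mu>. (\<lambda>k. - poly (pderiv (p k)) (h k x)) \<longlonglongrightarrow> - \<psi>' (v x)"
      using h(3) by eventually_elim (intro tendsto_minus p'_lim h(2))
    show "d \<le> - poly (pderiv (p k)) (h k x)" for k x using p'_bound[of k k x] by simp
  qed (use p_bound d neg in \<open>auto simp: less_imp_neq\<close>)
  show "- (\<integral>x. (f x)\<^sup>2 * \<psi> (v x) * u x \<partial>\<mu>) \<le> (\<integral>x. (\<psi> (v x))\<^sup>2 / - \<psi>' (v x) * \<Gamma> f f x \<partial>\<mu>)"
  proof (rule LIMSEQ_le[OF tendsto_minus[OF left(2)] right])
    show "\<exists>N. \<forall>k\<ge>N. - (\<integral>x. (f x)\<^sup>2 * poly (p k) (h k x) * L (h k) x \<partial>\<mu>)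
        \<le> (\<integral>x. (poly (p k) (h k x))\<^sup>2 / - poly (pderiv (p k)) (h k x) * \<Gamma> f f x \<partial>\<mu>)"
      using integral_poly_mult_L_le[OF f h(1) d p'_bound] by blast
  qed measurable
qed

lemma integral_inverse_weight_mult_L_closure_le:
  assumes f: "f \<in> \<A>" and vu: "L_closure v u" and v: "\<And>x. a \<le> v x"
    and w: "increasing_weight a w w'"
  shows "integrable \<mu> (\<lambda>x. (f x)\<^sup>2 / w (v x) * u x)"
    and "- (\<integral>x. (f x)\<^sup>2 / w (v x) * u x \<partial>\<mu>) \<le> (\<integral>x. \<Gamma> f f x / w' (v x) \<partial>\<mu>)"
proof -
  note w_pos = increasing_weight_pos[OF w] and w'_pos = increasing_weight_deriv_pos[OF w]
  define \<eta> where "\<eta> t = - (w' t / (w t)\<^sup>2)" for t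
  have "((\<lambda>t. 1 / w t) has_real_derivative \<eta> t) (at t within {a..})" if "a \<le> t" for t
    using increasing_weight_deriv[OF w that] w_pos[OF that]
    by (auto intro!: derivative_eq_intros simp: \<eta>_def power2_eq_square)
  moreover have \<eta>_cont: "continuous_on {a..} \<eta>"
    unfolding \<eta>_def using w_pos
    by (intro continuous_intros increasing_weight_continuous[OF w]
        increasing_weight_deriv_continuous[OF w])
      (auto simp: less_imp_neq[symmetric])
  ultimately obtain \<psi> where \<psi>: "\<And>t. (\<psi> has_real_derivative \<eta> (max a t)) (at t)"
      "\<And>t. a \<le> t \<Longrightarrow> \<psi> t = 1 / w t"
    by (rule C1_extension_Ici) auto
  have "continuous_on UNIV (\<lambda>t. \<eta> (max a t))"
    by (rule continuous_on_compose2[OF \<eta>_cont]) (auto intro!: continuous_intros)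
  moreover have "\<eta> (max a t) < 0" for t
    using w_pos[of "max a t"] w'_pos[of "max a t"] by (simp add: \<eta>_def)
  ultimately have int: "integrable \<mu> (\<lambda>x. (f x)\<^sup>2 * \<psi> (v x) * u x)"
    and le: "- (\<integral>x. (f x)\<^sup>2 * \<psi> (v x) * u x \<partial>\<mu>)
      \<le> (\<integral>x. (\<psi> (v x))\<^sup>2 / - \<eta> (max a (v x)) * \<Gamma> f f x \<partial>\<mu>)"
    by (rule integral_decreasing_mult_L_closure_le[OF f vu \<psi>(1)])+
  show "integrable \<mu> (\<lambda>x. (f x)\<^sup>2 / w (v x) * u x)"
    using int by (simp add: \<psi>(2)[OF v])
  have "(\<psi> (v x))\<^sup>2 / - \<eta> (max a (v x)) * \<Gamma> f f x = \<Gamma> f f x / w' (v x)" for x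
    using w_pos[OF v[of x]] v[of x]
    by (simp add: \<psi>(2) \<eta>_def max_absorb2 power_divide)
  then show "- (\<integral>x. (f x)\<^sup>2 / w (v x) * u x \<partial>\<mu>) \<le> (\<integral>x. \<Gamma> f f x / w' (v x) \<partial>\<mu>)"
    using le by (simp only: \<psi>(2)[OF v] mult_1_right times_divide_eq_right)
qed

end

section \<open>The Lyapunov inequality\<close>

definition concave_truncation :: "real \<Rightarrow> real \<Rightarrow> real"
  where "concave_truncation s t = 1 + (1 - max 0 (1 - s * (t - 1)) ^ 3) / (3 * s)"

lemma C2_truncation_concave_truncation:
  assumes s: "0 < s"
  shows "C2_truncation (concave_truncation s) (\<lambda>t. (max 0 (1 - s * (t - 1)))\<^sup>2)
    (\<lambda>t. - 2 * s * max 0 (1 - s * (t - 1)))"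
proof -
  have deriv: "((\<lambda>t. max 0 (1 - s * (t - 1)) ^ Suc (Suc n)) has_real_derivative
      real (Suc (Suc n)) * max 0 (1 - s * (t - 1)) ^ Suc n * (- s)) (at t)" for n t
    by (rule DERIV_chain2[OF has_real_derivative_max_0_power]) (auto intro!: derivative_eq_intros)
  have cube: "((\<lambda>t. max 0 (1 - s * (t - 1)) ^ 3) has_real_derivative
      - 3 * s * (max 0 (1 - s * (t - 1)))\<^sup>2) (at t)"
    and square: "((\<lambda>t. (max 0 (1 - s * (t - 1)))\<^sup>2) has_real_derivative
      - 2 * s * max 0 (1 - s * (t - 1))) (at t)" for t
    using deriv[of 1 t] deriv[of 0 t] by (simp_all add: numeral_3_eq_3 numeral_2_eq_2 algebra_simps)
  have "(concave_truncation s has_real_derivative (max 0 (1 - s * (t - 1)))\<^sup>2) (at t)" for t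
    unfolding concave_truncation_def[abs_def]
    by (rule DERIV_cong
          [OF DERIV_add[OF DERIV_const DERIV_cdivide[OF DERIV_diff[OF DERIV_const cube]]]])
      (use s in simp)
  moreover note square
  moreover have "continuous_on UNIV (\<lambda>t. - 2 * s * max 0 (1 - s * (t - 1)))"
    by (intro continuous_intros)
  moreover have "(max 0 (1 - s * (t - 1)))\<^sup>2 = 0" if "1 + 1 / s \<le> t" for t
    using that s by (simp add: field_simps)
  ultimately show ?thesis unfolding C2_truncation_def by blast
qed

lemma C2_truncation_measurable:
  assumes "C2_truncation T T' T''"
  shows "T \<in> borel_measurable borel" "T' \<in> borel_measurable borel" "T'' \<in> borel_measurable borel"
proof -
  have "(T has_real_derivative T' t) (at t)" "(T' has_real_derivative T'' t) (at t)" for t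
    using assms by (auto simp: C2_truncation_def)
  then have "continuous_on UNIV T" "continuous_on UNIV T'"
    by (auto intro: has_real_derivative_imp_continuous_on)
  moreover have "continuous_on UNIV T''" using assms by (simp add: C2_truncation_def)
  ultimately show "T \<in> borel_measurable borel" "T' \<in> borel_measurable borel"
    "T'' \<in> borel_measurable borel"
    by (simp_all add: borel_measurable_continuous_onI)
qed

lemma concave_truncation_ge_1:
  assumes "0 < s" "1 \<le> t" shows "1 \<le> concave_truncation s t"
proof -
  have "max 0 (1 - s * (t - 1)) ^ 3 \<le> 1" using assms by (intro power_le_one) auto
  then show ?thesis using assms(1) by (simp add: concave_truncation_def)
qed

lemma concave_truncation_tendsto:
  assumes s: "s \<longlonglongrightarrow> 0" and pos: "\<And>n. 0 < s n"
  shows "(\<lambda>n. concave_truncation (s n) t) \<longlonglongrightarrow> t"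
proof (rule Lim_transform_eventually)
  let ?r = "t - 1"
  have "(\<lambda>n. 1 + (?r - s n * ?r\<^sup>2 + (s n)\<^sup>2 * ?r ^ 3 / 3)) \<longlonglongrightarrow> 1 + (?r - 0 * ?r\<^sup>2 + 0\<^sup>2 * ?r ^ 3 / 3)"
    by (intro tendsto_intros s) simp
  then show "(\<lambda>n. 1 + (?r - s n * ?r\<^sup>2 + (s n)\<^sup>2 * ?r ^ 3 / 3)) \<longlonglongrightarrow> t" by simp
  have "(\<lambda>n. s n * ?r) \<longlonglongrightarrow> 0 * ?r" by (intro tendsto_intros s)
  then have "\<forall>\<^sub>F n in sequentially. s n * ?r < 1" by (rule order_tendstoD) simp
  then show "\<forall>\<^sub>F n in sequentially.
      1 + (?r - s n * ?r\<^sup>2 + (s n)\<^sup>2 * ?r ^ 3 / 3) = concave_truncation (s n) t"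
  proof eventually_elim
    case (elim n)
    have "1 - (1 - s n * r) ^ 3 = 3 * s n * (r - s n * r\<^sup>2 + (s n)\<^sup>2 * r ^ 3 / 3)" for r
      by (simp add: power2_eq_square power3_eq_cube algebra_simps)
    then show ?case using elim pos[of n] by (simp add: concave_truncation_def)
  qed
qed

lemma truncated_integrand_tendsto:
  fixes w :: "real \<Rightarrow> real"
  assumes w: "continuous_on {1..} w" "w t \<noteq> 0" and "1 \<le> t" and s: "s \<longlonglongrightarrow> 0" "\<And>n. 0 < s n"
  shows "(\<lambda>n. F * ((max 0 (1 - s n * (t - 1)))\<^sup>2 * y) / w (concave_truncation (s n) t))
    \<longlonglongrightarrow> F * (y / w t)"
proof -
  have "(\<lambda>n. w (concave_truncation (s n) t)) \<longlonglongrightarrow> w t"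
    by (rule continuous_on_tendsto_compose[OF w(1) concave_truncation_tendsto[OF s]])
      (use \<open>1 \<le> t\<close> concave_truncation_ge_1 s(2) in auto)
  then have "(\<lambda>n. F * ((max 0 (1 - s n * (t - 1)))\<^sup>2 * y) / w (concave_truncation (s n) t))
      \<longlonglongrightarrow> F * ((max 0 (1 - 0 * (t - 1)))\<^sup>2 * y) / w t"
    by (intro tendsto_intros s w(2))
  then show ?thesis by simp
qed

locale lyapunov_diffusion = symmetric_diffusion \<mu> D \<A> L
  for \<mu> :: "(real ^ 'n) measure" and D \<A> L +
  fixes W LW :: "real ^ 'n \<Rightarrow> real" and \<phi> :: "real \<Rightarrow> real" and b :: real and B :: "(real ^ 'n) set"
  assumes W_smooth: "smooth_enough \<mu> \<A> L W LW"
    and W_ge_1: "1 \<le> W x"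
    and phi_continuous: "continuous_on {1..} \<phi>"
    and phi_pos: "1 \<le> t \<Longrightarrow> 0 < \<phi> t"
    and b_nonneg: "0 \<le> b"
    and B_sets[measurable]: "B \<in> sets \<mu>"
    and lyapunov: "AE x in \<mu>. LW x \<le> - \<phi> (W x) + b * indicator B x"
begin

lemma W_measurable[measurable]: "W \<in> borel_measurable \<mu>"
  using W_smooth by (simp add: smooth_enough_def)

lemma phi_W_measurable[measurable]: "(\<lambda>x. \<phi> (W x)) \<in> borel_measurable \<mu>"
  by (rule borel_measurable_compose_Ici[OF phi_continuous W_measurable W_ge_1])

lemma W_pos: "0 < W x"
  using W_ge_1[of x] by linarith

lemma phi_W_pos: "0 < \<phi> (W x)"
  by (rule phi_pos[OF W_ge_1])

lemma truncated_L_closure: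
  assumes T: "C2_truncation T T' T''" and T': "\<And>t. 0 \<le> T' t" "\<And>t. 1 \<le> t \<Longrightarrow> T' t \<le> 1"
    and T'': "\<And>t. T'' t \<le> 0"
  obtains u where "L_closure (\<lambda>x. T (W x)) u"
    "AE x in \<mu>. T' (W x) * \<phi> (W x) \<le> - u x + b * indicator B x"
proof -
  obtain \<Gamma>W where [measurable]: "LW \<in> borel_measurable \<mu>" "\<Gamma>W \<in> borel_measurable \<mu>"
    and \<Gamma>W: "AE x in \<mu>. 0 \<le> \<Gamma>W x"
    and h: "\<exists>h. (\<forall>k. h k \<in> \<A>) \<and> (\<exists>K. \<forall>k x. \<bar>h k x\<bar> \<le> K) \<and> (AE x in \<mu>. (\<lambda>k. h k x) \<longlonglongrightarrow> T (W x)) \<and>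
      (\<lambda>k. \<integral>\<^sup>+ x. ennreal \<bar>L (h k) x - (T' (W x) * LW x + T'' (W x) * \<Gamma>W x)\<bar> \<partial>\<mu>) \<longlonglongrightarrow> 0"
    using W_smooth T unfolding smooth_enough_def by blast
  note [measurable] = C2_truncation_measurable[OF T]
  define u where "u x = T' (W x) * LW x + T'' (W x) * \<Gamma>W x" for x
  show ?thesis
  proof (rule that)
    have "(\<lambda>x. T (W x)) \<in> borel_measurable \<mu>" "u \<in> borel_measurable \<mu>"
      unfolding u_def by measurable
    with h show "L_closure (\<lambda>x. T (W x)) u" unfolding L_closure_def u_def by blast
    show "AE x in \<mu>. T' (W x) * \<phi> (W x) \<le> - u x + b * indicator B x"
      using \<Gamma>W lyapunov
    proof eventually_elim
      case (elim x)
      have "T' (W x) * \<phi> (W x) \<le> T' (W x) * (b * indicator B x - LW x)"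
        using elim(2) by (intro mult_left_mono T'(1)) simp
      also have "\<dots> \<le> b * indicator B x - T' (W x) * LW x"
        using mult_right_mono[OF T'(2)[OF W_ge_1], of "b * indicator B x" x] b_nonneg
        by (simp add: right_diff_distrib)
      also have "\<dots> \<le> - u x + b * indicator B x"
        using mult_nonpos_nonneg[OF T'' elim(1), of "W x"] by (simp add: u_def)
      finally show ?case .
    qed
  qed
qed

lemma truncated_lyapunov_inequality:
  assumes f: "f \<in> \<A>" and w: "increasing_weight 1 w w'"
    and T: "C2_truncation T T' T''" and T': "\<And>t. 0 \<le> T' t" "\<And>t. 1 \<le> t \<Longrightarrow> T' t \<le> 1"
    and T'': "\<And>t. T'' t \<le> 0" and T_ge_1: "\<And>t. 1 \<le> t \<Longrightarrow> 1 \<le> T t"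
  defines "G \<equiv> \<lambda>x. (f x)\<^sup>2 * (T' (W x) * \<phi> (W x)) / w (T (W x))"
  shows "integrable \<mu> G"
    and "(\<integral>x. G x \<partial>\<mu>) \<le> (\<integral>x. \<Gamma> f f x / w' (T (W x)) \<partial>\<mu>) + b / w 1 * (LINT x:B|\<mu>. (f x)\<^sup>2)"
proof -
  obtain u where closure: "L_closure (\<lambda>x. T (W x)) u"
    and u: "AE x in \<mu>. T' (W x) * \<phi> (W x) \<le> - u x + b * indicator B x"
    by (rule truncated_L_closure[OF T T' T'']) auto
  note parts = integral_inverse_weight_mult_L_closure_le[OF f closure T_ge_1[OF W_ge_1] w]
  define H where "H x = - ((f x)\<^sup>2 / w (T (W x)) * u x) + b / w 1 * ((f x)\<^sup>2 * indicator B x)" for x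
  have sq_B: "integrable \<mu> (\<lambda>x. (f x)\<^sup>2 * indicator B x)"
    using integrable_mult_indicator[OF B_sets alg_integrable[OF alg_square[OF f]]]
    by (simp add: mult.commute)
  have H_int: "integrable \<mu> H"
    unfolding H_def using parts(1) sq_B by simp
  have w_pos: "0 < w 1" "0 < w (T (W x))" for x
    using increasing_weight_pos[OF w] T_ge_1[OF W_ge_1] by auto
  have G_nonneg: "0 \<le> G x" for x
    unfolding G_def using T'(1) phi_W_pos[of x] w_pos(2)[of x] by (simp add: less_imp_le)
  have G_le_H: "AE x in \<mu>. G x \<le> H x"
    using u
  proof eventually_elim
    case (elim x)
    have "G x \<le> - ((f x)\<^sup>2 / w (T (W x)) * u x) + (f x)\<^sup>2 * (b * indicator B x) / w 1"
      unfolding G_def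
      by (rule mult_divide_le_of_weight_ge
            [OF _ w_pos(1) increasing_weight_ge[OF w T_ge_1[OF W_ge_1]] elim])
        (use b_nonneg in simp_all)
    then show ?case by (simp add: H_def mult_ac)
  qed
  note [measurable] = alg_measurable[OF f] C2_truncation_measurable[OF T]
  have [measurable]: "(\<lambda>x. w (T (W x))) \<in> borel_measurable \<mu>"
    by (rule borel_measurable_compose_Ici
          [OF increasing_weight_continuous[OF w] _ T_ge_1[OF W_ge_1]]) measurable
  show G_int: "integrable \<mu> G"
  proof (rule Bochner_Integration.integrable_bound[OF H_int])
    show "G \<in> borel_measurable \<mu>" unfolding G_def by measurable
    show "AE x in \<mu>. norm (G x) \<le> norm (H x)"
      using G_le_H by eventually_elim (use G_nonneg in \<open>auto intro: order_trans\<close>)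
  qed
  have "(\<integral>x. G x \<partial>\<mu>) \<le> (\<integral>x. H x \<partial>\<mu>)" by (rule integral_mono_AE[OF G_int H_int G_le_H])
  also have "\<dots> = - (\<integral>x. (f x)\<^sup>2 / w (T (W x)) * u x \<partial>\<mu>) + b / w 1 * (LINT x:B|\<mu>. (f x)\<^sup>2)"
    unfolding H_def using parts(1) sq_B by (simp add: set_lebesgue_integral_def mult.commute)
  finally show "(\<integral>x. G x \<partial>\<mu>) \<le> (\<integral>x. \<Gamma> f f x / w' (T (W x)) \<partial>\<mu>) + b / w 1 * (LINT x:B|\<mu>. (f x)\<^sup>2)"
    using parts(2) by linarith
qed

lemma integral_gamma_divide_weight_tendsto:
  assumes f: "f \<in> \<A>" and w: "increasing_weight 1 w w'"
    and \<epsilon>: "0 < \<epsilon>" "\<And>t. 1 \<le> t \<Longrightarrow> \<epsilon> \<le> w' t"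
    and V: "\<And>n. V n \<in> borel_measurable \<mu>" "\<And>n x. 1 \<le> V n x" "\<And>x. (\<lambda>n. V n x) \<longlonglongrightarrow> W x"
  shows "(\<lambda>n. \<integral>x. \<Gamma> f f x / w' (V n x) \<partial>\<mu>) \<longlonglongrightarrow> (\<integral>x. \<Gamma> f f x / w' (W x) \<partial>\<mu>)"
proof (rule integral_dominated_convergence)
  note w' = increasing_weight_deriv_continuous[OF w]
  note [measurable] = gamma_measurable[OF f f]
    borel_measurable_compose_Ici[OF w' W_measurable W_ge_1]
    borel_measurable_compose_Ici[OF w' V(1,2)]
  show "(\<lambda>x. \<Gamma> f f x / w' (W x)) \<in> borel_measurable \<mu>"
    and "(\<lambda>x. \<Gamma> f f x / w' (V n x)) \<in> borel_measurable \<mu>" for n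
    by measurable
  show "integrable \<mu> (\<lambda>x. \<Gamma> f f x / \<epsilon>)"
    using gamma_integrable[OF f f] by simp
  have "(\<lambda>n. w' (V n x)) \<longlonglongrightarrow> w' (W x)" for x
    by (rule continuous_on_tendsto_compose[OF w' V(3)]) (use W_ge_1 V(2) in auto)
  then show "AE x in \<mu>. (\<lambda>n. \<Gamma> f f x / w' (V n x)) \<longlonglongrightarrow> \<Gamma> f f x / w' (W x)"
    using increasing_weight_deriv_pos[OF w W_ge_1]
    by (intro AE_I2 tendsto_divide tendsto_const) (simp_all add: less_imp_neq[symmetric])
  show "AE x in \<mu>. norm (\<Gamma> f f x / w' (V n x)) \<le> \<Gamma> f f x / \<epsilon>" for n
    using gamma_nonneg[OF f]
  proof eventually_elim
    case (elim x)
    then show ?case using \<epsilon>(1) \<epsilon>(2)[OF V(2), of n x] by (simp add: frac_le)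
  qed
qed

lemma lyapunov_inequality:
  assumes f: "f \<in> \<A>" and w: "increasing_weight 1 w w'"
    and \<epsilon>: "0 < \<epsilon>" "\<And>t. 1 \<le> t \<Longrightarrow> \<epsilon> \<le> w' t"
  shows "integrable \<mu> (\<lambda>x. (f x)\<^sup>2 * (\<phi> (W x) / w (W x)))"
    and "(\<integral>x. (f x)\<^sup>2 * (\<phi> (W x) / w (W x)) \<partial>\<mu>)
      \<le> (\<integral>x. \<Gamma> f f x / w' (W x) \<partial>\<mu>) + b / w 1 * (LINT x:B|\<mu>. (f x)\<^sup>2)"
proof -
  define s where "s n = inverse (real (Suc n))" for n
  have s: "s \<longlonglongrightarrow> 0" "0 < s n" for n
    unfolding s_def by (rule LIMSEQ_inverse_real_of_nat) simp
  define T' where "T' n t = (max 0 (1 - s n * (t - 1)))\<^sup>2" for n t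
  define G where "G n x = (f x)\<^sup>2 * (T' n (W x) * \<phi> (W x)) / w (concave_truncation (s n) (W x))" for n x
  note T = C2_truncation_concave_truncation[OF s(2), folded T'_def]
    and T_ge_1 = concave_truncation_ge_1[OF s(2)]
  have T': "0 \<le> T' n t" "1 \<le> t \<Longrightarrow> T' n t \<le> 1" for n t
    using s(2)[of n] by (auto simp: T'_def intro!: power_le_one)
  have truncated: "integrable \<mu> (G n)" "(\<integral>x. G n x \<partial>\<mu>)
      \<le> (\<integral>x. \<Gamma> f f x / w' (concave_truncation (s n) (W x)) \<partial>\<mu>) + b / w 1 * (LINT x:B|\<mu>. (f x)\<^sup>2)" for n
    unfolding G_def
    by (rule truncated_lyapunov_inequality[OF f w T T' _ T_ge_1];
        use s(2)[of n] in \<open>simp add: mult_nonneg_nonneg less_imp_le\<close>)+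
  have G_nonneg: "0 \<le> G n x" for n x
    unfolding G_def
    using T'(1) phi_W_pos[of x] increasing_weight_pos[OF w T_ge_1[OF W_ge_1], of n x]
    by (simp add: less_imp_le)
  have "w (W x) \<noteq> 0" for x using increasing_weight_pos[OF w W_ge_1[of x]] by simp
  then have G_lim: "(\<lambda>n. G n x) \<longlonglongrightarrow> (f x)\<^sup>2 * (\<phi> (W x) / w (W x))" for x
    unfolding G_def T'_def
    by (rule truncated_integrand_tendsto[OF increasing_weight_continuous[OF w] _ W_ge_1 s])
  have bound_lim: "(\<lambda>n. (\<integral>x. \<Gamma> f f x / w' (concave_truncation (s n) (W x)) \<partial>\<mu>)
        + b / w 1 * (LINT x:B|\<mu>. (f x)\<^sup>2))
      \<longlonglongrightarrow> (\<integral>x. \<Gamma> f f x / w' (W x) \<partial>\<mu>) + b / w 1 * (LINT x:B|\<mu>. (f x)\<^sup>2)"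
    by (intro tendsto_add tendsto_const integral_gamma_divide_weight_tendsto[OF f w \<epsilon>]
        measurable_compose[OF W_measurable C2_truncation_measurable(1)[OF T]] T_ge_1 W_ge_1
        concave_truncation_tendsto[OF s])
  note limit = fatou_integral_le
    [OF truncated(1) AE_I2[OF G_nonneg] _ AE_I2[OF G_lim] truncated(2) bound_lim]
  note [measurable] = alg_measurable[OF f]
    borel_measurable_compose_Ici[OF increasing_weight_continuous[OF w] W_measurable W_ge_1]
  show "integrable \<mu> (\<lambda>x. (f x)\<^sup>2 * (\<phi> (W x) / w (W x)))"
    by (rule limit(1)) measurable
  show "(\<integral>x. (f x)\<^sup>2 * (\<phi> (W x) / w (W x)) \<partial>\<mu>)
      \<le> (\<integral>x. \<Gamma> f f x / w' (W x) \<partial>\<mu>) + b / w 1 * (LINT x:B|\<mu>. (f x)\<^sup>2)"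
    by (rule limit(2)) measurable
qed

end

section \<open>Poincare inequalities\<close>

locale lyapunov_poincare = lyapunov_diffusion \<mu> D \<A> L W LW \<phi> b B
  for \<mu> :: "(real ^ 'n) measure" and D \<A> L W LW \<phi> b B +
  fixes \<kappa> :: real
  assumes local_poincare: "f \<in> \<A> \<Longrightarrow> (LINT x:B|\<mu>. (f x)\<^sup>2)
    \<le> \<kappa> * energy f + inverse (measure \<mu> B) * (LINT x:B|\<mu>. f x)\<^sup>2"
begin

lemma local_poincare_centred:
  assumes f: "f \<in> \<A>"
  obtains c where "(LINT x:B|\<mu>. (f x - c)\<^sup>2) \<le> \<kappa> * energy f" "AE x in \<mu>. \<bar>f x - c\<bar> \<le> Osc \<mu> f"
proof (rule that)
  let ?c = "local_mean B f"
  obtain K where "\<And>x. \<bar>f x\<bar> \<le> K" using alg_bounded[OF f] by blast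
  then show "AE x in \<mu>. \<bar>f x - ?c\<bar> \<le> Osc \<mu> f"
    by (rule AE_abs_diff_local_mean_le_Osc[OF alg_measurable[OF f] _ B_sets])
  have "inverse (prob B) * (LINT x:B|\<mu>. f x - ?c)\<^sup>2 = 0"
    using set_integral_diff_local_mean[OF B_sets alg_integrable[OF f]] by (cases "prob B = 0") auto
  then show "(LINT x:B|\<mu>. (f x - ?c)\<^sup>2) \<le> \<kappa> * energy f"
    using local_poincare[OF alg_diff_const[OF f], of ?c]
    unfolding energy_diff_const[OF f] by linarith
qed

lemma weighted_inequality:
  assumes f: "f \<in> \<A>" and c: "(LINT x:B|\<mu>. (f x - c)\<^sup>2) \<le> \<kappa> * energy f"
    and w: "increasing_weight 1 w w'" and \<epsilon>: "0 < \<epsilon>" "\<And>t. 1 \<le> t \<Longrightarrow> \<epsilon> \<le> w' t"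
  shows "integrable \<mu> (\<lambda>x. (f x - c)\<^sup>2 * (\<phi> (W x) / w (W x)))"
    and "(\<integral>x. (f x - c)\<^sup>2 * (\<phi> (W x) / w (W x)) \<partial>\<mu>)
      \<le> (\<integral>x. \<Gamma> f f x / w' (W x) \<partial>\<mu>) + b / w 1 * (\<kappa> * energy f)"
proof -
  note fc = alg_diff_const[OF f, of c]
  note shifted = lyapunov_inequality[OF fc w \<epsilon>]
  show "integrable \<mu> (\<lambda>x. (f x - c)\<^sup>2 * (\<phi> (W x) / w (W x)))" by (rule shifted(1))
  note [measurable] = gamma_measurable[OF fc fc] gamma_measurable[OF f f]
    borel_measurable_compose_Ici[OF increasing_weight_deriv_continuous[OF w] W_measurable W_ge_1]
  have "(\<integral>x. \<Gamma> (\<lambda>y. f y - c) (\<lambda>y. f y - c) x / w' (W x) \<partial>\<mu>) = (\<integral>x. \<Gamma> f f x / w' (W x) \<partial>\<mu>)"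
    by (rule integral_cong_AE) (use gamma_diff_const[OF f, of c] in \<open>auto elim: eventually_mono\<close>)
  moreover have "b / w 1 * (LINT x:B|\<mu>. (f x - c)\<^sup>2) \<le> b / w 1 * (\<kappa> * energy f)"
    using b_nonneg increasing_weight_pos[OF w, of 1] by (intro mult_left_mono c) simp
  ultimately show "(\<integral>x. (f x - c)\<^sup>2 * (\<phi> (W x) / w (W x)) \<partial>\<mu>)
      \<le> (\<integral>x. \<Gamma> f f x / w' (W x) \<partial>\<mu>) + b / w 1 * (\<kappa> * energy f)"
    using shifted(2) by linarith
qed

lemma converse_weighted_inequality:
  assumes f: "f \<in> \<A>" and c: "(LINT x:B|\<mu>. (f x - c)\<^sup>2) \<le> \<kappa> * energy f"
  shows "integrable \<mu> (\<lambda>x. (f x - c)\<^sup>2 * (\<phi> (W x) / W x))"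
    and "(\<integral>x. (f x - c)\<^sup>2 * (\<phi> (W x) / W x) \<partial>\<mu>) \<le> (1 + b * \<kappa>) * energy f"
proof -
  have "increasing_weight 1 (\<lambda>t. t) (\<lambda>t. 1)"
    by (auto simp: increasing_weight_def intro!: derivative_eq_intros)
  note weighted = weighted_inequality[OF f c this zero_less_one order_refl]
  show "integrable \<mu> (\<lambda>x. (f x - c)\<^sup>2 * (\<phi> (W x) / W x))" by (rule weighted(1))
  show "(\<integral>x. (f x - c)\<^sup>2 * (\<phi> (W x) / W x) \<partial>\<mu>) \<le> (1 + b * \<kappa>) * energy f"
    using weighted(2) by (simp add: algebra_simps)
qed

theorem converse_weighted_poincare:
  assumes f: "f \<in> \<A>"
  shows "(INF c::real. \<integral>x. (f x - c)\<^sup>2 * (\<phi> (W x) / W x) \<partial>\<mu>) \<le> (1 + b * \<kappa>) * energy f"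
proof -
  obtain c where c: "(LINT x:B|\<mu>. (f x - c)\<^sup>2) \<le> \<kappa> * energy f"
    by (rule local_poincare_centred[OF f])
  have "0 \<le> (\<integral>x. (f x - a)\<^sup>2 * (\<phi> (W x) / W x) \<partial>\<mu>)" for a
    using W_pos phi_W_pos by (intro integral_nonneg_AE AE_I2) (simp add: less_imp_le)
  then have "bdd_below (range (\<lambda>c. \<integral>x. (f x - c)\<^sup>2 * (\<phi> (W x) / W x) \<partial>\<mu>))"
    by (auto intro!: bdd_belowI[of _ 0])
  then have "(INF c::real. \<integral>x. (f x - c)\<^sup>2 * (\<phi> (W x) / W x) \<partial>\<mu>)
      \<le> (\<integral>x. (f x - c)\<^sup>2 * (\<phi> (W x) / W x) \<partial>\<mu>)"
    by (rule cINF_lower) simp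
  also have "\<dots> \<le> (1 + b * \<kappa>) * energy f" by (rule converse_weighted_inequality(2)[OF f c])
  finally show ?thesis .
qed

theorem weak_poincare:
  assumes f: "f \<in> \<A>" and s: "0 < s" "s < 1"
  shows "Var \<mu> f \<le> (1 + b * \<kappa>) / quantile_inv (\<lambda>u. measure \<mu> {x. \<phi> (W x) < u * W x}) s * energy f
    + s * (Osc \<mu> f)\<^sup>2"
proof -
  define r where "r x = \<phi> (W x) / W x" for x
  have r: "r \<in> borel_measurable \<mu>" "\<And>x. 0 < r x"
    unfolding r_def using W_pos phi_W_pos by auto
  have "{x. \<phi> (W x) < u * W x} = {x \<in> space \<mu>. r x < u}" for u
    using W_pos by (auto simp: r_def space_UNIV divide_less_eq)
  then have quantile_eq: "quantile_inv (\<lambda>u. measure \<mu> {x. \<phi> (W x) < u * W x}) s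
      = quantile_inv (\<lambda>u. prob {x \<in> space \<mu>. r x < u}) s"
    by simp
  define q where "q = quantile_inv (\<lambda>u. prob {x \<in> space \<mu>. r x < u}) s"
  note q = quantile_inv_prob_less[OF r s, folded q_def]
  obtain c where c: "(LINT x:B|\<mu>. (f x - c)\<^sup>2) \<le> \<kappa> * energy f" "AE x in \<mu>. \<bar>f x - c\<bar> \<le> Osc \<mu> f"
    by (rule local_poincare_centred[OF f])
  note converse = converse_weighted_inequality[OF f c(1), folded r_def]
  have "Var \<mu> f \<le> (\<integral>x. (f x - c)\<^sup>2 \<partial>\<mu>)"
    by (intro Var_le_integral_square_diff alg_integrable alg_square f)
  also have "\<dots> \<le> (\<integral>x. (f x - c)\<^sup>2 * r x \<partial>\<mu>) / q + (Osc \<mu> f)\<^sup>2 * prob {x \<in> space \<mu>. r x < q}"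
  proof (rule integral_le_weighted_add_prob_less)
    show "AE x in \<mu>. (f x - c)\<^sup>2 \<le> (Osc \<mu> f)\<^sup>2"
      using c(2) by eventually_elim (simp add: abs_le_square_iff[symmetric])
    show "integrable \<mu> (\<lambda>x. (f x - c)\<^sup>2)"
      by (intro alg_integrable alg_square alg_diff_const f)
  qed (use r q(1) converse(1) in auto)
  also have "\<dots> \<le> (1 + b * \<kappa>) * energy f / q + (Osc \<mu> f)\<^sup>2 * s"
    using converse(2) q by (intro add_mono divide_right_mono mult_left_mono) auto
  finally show ?thesis by (simp add: quantile_eq q_def mult.commute)
qed

lemma ennreal_integral_gamma_divide_le:
  assumes f: "f \<in> \<A>" and [measurable]: "k \<in> borel_measurable \<mu>" and k: "\<And>x. 0 \<le> k x" and \<epsilon>: "0 < \<epsilon>"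
  shows "ennreal (\<integral>x. \<Gamma> f f x / (k x + \<epsilon>) \<partial>\<mu>) \<le> (\<integral>\<^sup>+ x. 1 / ennreal (k x) * ennreal (\<Gamma> f f x) \<partial>\<mu>)"
proof -
  note [measurable] = gamma_measurable[OF f f]
  have nonneg: "AE x in \<mu>. 0 \<le> \<Gamma> f f x / (k x + \<epsilon>)"
    using gamma_nonneg[OF f] by eventually_elim (use k \<epsilon> in \<open>simp add: add_nonneg_nonneg\<close>)
  have "ennreal (\<integral>x. \<Gamma> f f x / (k x + \<epsilon>) \<partial>\<mu>) \<le> (\<integral>\<^sup>+ x. ennreal (\<Gamma> f f x / (k x + \<epsilon>)) \<partial>\<mu>)"
    using nonneg by (simp add: integral_eq_nn_integral ennreal_enn2real_if)
  also have "\<dots> \<le> (\<integral>\<^sup>+ x. 1 / ennreal (k x) * ennreal (\<Gamma> f f x) \<partial>\<mu>)"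
    by (rule nn_integral_mono_AE, use gamma_nonneg[OF f] in eventually_elim)
      (intro ennreal_divide_add_le k \<epsilon>)
  finally show ?thesis .
qed

text \<open>
  The weight \<open>\<phi>\<close> itself is not allowed, because its derivative may vanish; in the limit
  \<open>\<epsilon> \<rightarrow> 0\<close> the convention $1/0 = \infty$ of \<^typ>\<open>ennreal\<close> takes care of the points where it does.
\<close>

lemma regularized_weighted_inequality:
  assumes f: "f \<in> \<A>" and c: "(LINT x:B|\<mu>. (f x - c)\<^sup>2) \<le> \<kappa> * energy f"
    and phi_deriv: "\<And>t. 1 \<le> t \<Longrightarrow> (\<phi> has_real_derivative \<phi>' t) (at t within {1..})"
    and phi'_cont: "continuous_on {1..} \<phi>'" and phi'_nonneg: "\<And>t. 1 \<le> t \<Longrightarrow> 0 \<le> \<phi>' t"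
    and \<epsilon>: "0 < \<epsilon>"
  shows "(\<integral>x. (f x - c)\<^sup>2 * (\<phi> (W x) / (\<phi> (W x) + \<epsilon> * W x)) \<partial>\<mu>)
    \<le> (\<integral>x. \<Gamma> f f x / (\<phi>' (W x) + \<epsilon>) \<partial>\<mu>) + b * \<kappa> / \<phi> 1 * energy f"
proof -
  have "0 < \<phi> t + \<epsilon> * t" "0 < \<phi>' t + \<epsilon>" if "1 \<le> t" for t
    using phi_pos[OF that] phi'_nonneg[OF that] \<epsilon> that
    by (simp_all add: add_pos_nonneg add_nonneg_pos)
  moreover have "((\<lambda>t. \<phi> t + \<epsilon> * t) has_real_derivative \<phi>' t + \<epsilon>) (at t within {1..})"
    if "1 \<le> t" for t
    using DERIV_add[OF phi_deriv[OF that] DERIV_cmult[OF DERIV_ident, of \<epsilon>]] by simp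
  moreover have "continuous_on {1..} (\<lambda>t. \<phi>' t + \<epsilon>)"
    by (intro continuous_intros phi'_cont)
  ultimately have w: "increasing_weight 1 (\<lambda>t. \<phi> t + \<epsilon> * t) (\<lambda>t. \<phi>' t + \<epsilon>)"
    by (simp add: increasing_weight_def)
  have "0 \<le> (LINT x:B|\<mu>. (f x - c)\<^sup>2)" by (simp add: set_lebesgue_integral_def)
  then have "b / (\<phi> 1 + \<epsilon> * 1) * (\<kappa> * energy f) \<le> b / \<phi> 1 * (\<kappa> * energy f)"
    using c b_nonneg phi_pos[of 1] \<epsilon> by (intro mult_right_mono divide_left_mono) auto
  then show ?thesis
    using weighted_inequality(2)[OF f c w \<epsilon>] phi'_nonneg by simp
qed

lemma regularized_weighted_inequality_ennreal:
  assumes f: "f \<in> \<A>" and c: "(LINT x:B|\<mu>. (f x - c)\<^sup>2) \<le> \<kappa> * energy f"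
    and phi_deriv: "\<And>t. 1 \<le> t \<Longrightarrow> (\<phi> has_real_derivative \<phi>' t) (at t within {1..})"
    and phi'_cont: "continuous_on {1..} \<phi>'" and phi'_nonneg: "\<And>t. 1 \<le> t \<Longrightarrow> 0 \<le> \<phi>' t"
    and \<epsilon>: "0 < \<epsilon>"
  shows "ennreal (\<integral>x. (f x - c)\<^sup>2 * (\<phi> (W x) / (\<phi> (W x) + \<epsilon> * W x)) \<partial>\<mu>)
    \<le> ennreal (max (b * \<kappa> / \<phi> 1) 1) *
      (\<integral>\<^sup>+ x. (1 + 1 / ennreal (\<phi>' (W x))) * ennreal (\<Gamma> f f x) \<partial>\<mu>)"
proof -
  define m where "m = max (b * \<kappa> / \<phi> 1) 1"
  define I where "I = (\<integral>x. \<Gamma> f f x / (\<phi>' (W x) + \<epsilon>) \<partial>\<mu>)"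
  define H where "H = (\<integral>\<^sup>+ x. 1 / ennreal (\<phi>' (W x)) * ennreal (\<Gamma> f f x) \<partial>\<mu>)"
  have m: "1 \<le> ennreal m" "0 \<le> m" by (auto simp: m_def)
  have energy_le: "b * \<kappa> / \<phi> 1 * energy f \<le> m * energy f"
    unfolding m_def by (intro mult_right_mono energy_nonneg f) simp
  note [measurable] = gamma_measurable[OF f f]
    borel_measurable_compose_Ici[OF phi'_cont W_measurable W_ge_1]
  have "ennreal I \<le> H"
    unfolding I_def H_def
    by (rule ennreal_integral_gamma_divide_le[OF f _ phi'_nonneg[OF W_ge_1] \<epsilon>]) measurable
  also have "\<dots> \<le> ennreal m * H"
    using mult_right_mono[OF m(1), of H] by simp
  finally have I_le: "ennreal I \<le> ennreal m * H" .
  have I_nonneg: "0 \<le> I"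
    unfolding I_def by (rule integral_nonneg_AE, use gamma_nonneg[OF f] in eventually_elim)
      (use phi'_nonneg[OF W_ge_1] \<epsilon> in \<open>simp add: add_nonneg_nonneg\<close>)
  have "(\<integral>x. (f x - c)\<^sup>2 * (\<phi> (W x) / (\<phi> (W x) + \<epsilon> * W x)) \<partial>\<mu>) \<le> I + m * energy f"
    using regularized_weighted_inequality[OF f c phi_deriv phi'_cont phi'_nonneg \<epsilon>] energy_le
    unfolding I_def by linarith
  then have "ennreal (\<integral>x. (f x - c)\<^sup>2 * (\<phi> (W x) / (\<phi> (W x) + \<epsilon> * W x)) \<partial>\<mu>)
      \<le> ennreal (I + m * energy f)"
    by (rule ennreal_leI)
  also have "\<dots> = ennreal I + ennreal (m * energy f)"
    using I_nonneg m(2) energy_nonneg[OF f] by (intro ennreal_plus) auto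
  also have "\<dots> \<le> ennreal m * H + ennreal m * ennreal (energy f)"
    using I_le m(2) by (intro add_mono) (simp_all add: ennreal_mult')
  also have "\<dots> = ennreal m * (\<integral>\<^sup>+ x. (1 + 1 / ennreal (\<phi>' (W x))) * ennreal (\<Gamma> f f x) \<partial>\<mu>)"
    using nn_integral_eq_integral[OF gamma_integrable[OF f f] gamma_nonneg[OF f]]
    by (simp add: H_def distrib_right distrib_left nn_integral_add add.commute)
  finally show ?thesis by (simp add: m_def)
qed

lemma regularized_integral_tendsto:
  fixes g :: "real ^ 'n \<Rightarrow> real"
  assumes g: "integrable \<mu> g" and \<epsilon>: "\<epsilon> \<longlonglongrightarrow> 0" "\<And>n. 0 < \<epsilon> n"
  shows "(\<lambda>n. \<integral>x. g x * (\<phi> (W x) / (\<phi> (W x) + \<epsilon> n * W x)) \<partial>\<mu>) \<longlonglongrightarrow> (\<integral>x. g x \<partial>\<mu>)"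
proof (rule integral_dominated_convergence)
  note [measurable] = borel_measurable_integrable[OF g]
  show "g \<in> borel_measurable \<mu>"
    and "(\<lambda>x. g x * (\<phi> (W x) / (\<phi> (W x) + \<epsilon> n * W x))) \<in> borel_measurable \<mu>" for n
    by measurable
  show "integrable \<mu> (\<lambda>x. \<bar>g x\<bar>)" by (rule integrable_abs[OF g])
  have "(\<lambda>n. g x * (\<phi> (W x) / (\<phi> (W x) + \<epsilon> n * W x))) \<longlonglongrightarrow> g x * (\<phi> (W x) / (\<phi> (W x) + 0 * W x))" for x
    using phi_W_pos[of x] by (intro tendsto_intros \<epsilon>(1)) simp
  then show "AE x in \<mu>. (\<lambda>n. g x * (\<phi> (W x) / (\<phi> (W x) + \<epsilon> n * W x))) \<longlonglongrightarrow> g x"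
    using phi_W_pos by (simp add: less_imp_neq[symmetric])
  have "\<bar>\<phi> (W x) / (\<phi> (W x) + \<epsilon> n * W x)\<bar> \<le> 1" for n x
    using phi_W_pos[of x] mult_pos_pos[OF \<epsilon>(2)[of n] W_pos[of x]] by simp
  then show "AE x in \<mu>. norm (g x * (\<phi> (W x) / (\<phi> (W x) + \<epsilon> n * W x))) \<le> \<bar>g x\<bar>" for n
    by (simp only: real_norm_def abs_mult mult_left_le abs_ge_zero AE_I2)
qed

theorem weighted_poincare:
  assumes f: "f \<in> \<A>"
    and phi_deriv: "\<And>t. 1 \<le> t \<Longrightarrow> (\<phi> has_real_derivative \<phi>' t) (at t within {1..})"
    and phi'_cont: "continuous_on {1..} \<phi>'" and phi'_nonneg: "\<And>t. 1 \<le> t \<Longrightarrow> 0 \<le> \<phi>' t"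
  shows "ennreal (Var \<mu> f) \<le> ennreal (max (b * \<kappa> / \<phi> 1) 1) *
    (\<integral>\<^sup>+ x. (1 + 1 / ennreal (\<phi>' (W x))) * ennreal (\<Gamma> f f x) \<partial>\<mu>)"
proof -
  obtain c where c: "(LINT x:B|\<mu>. (f x - c)\<^sup>2) \<le> \<kappa> * energy f"
    by (rule local_poincare_centred[OF f])
  have "integrable \<mu> (\<lambda>x. (f x - c)\<^sup>2)"
    by (intro alg_integrable alg_square alg_diff_const f)
  note limit = regularized_integral_tendsto[OF this LIMSEQ_inverse_real_of_nat]
  have "ennreal (\<integral>x. (f x - c)\<^sup>2 \<partial>\<mu>) \<le> ennreal (max (b * \<kappa> / \<phi> 1) 1) *
      (\<integral>\<^sup>+ x. (1 + 1 / ennreal (\<phi>' (W x))) * ennreal (\<Gamma> f f x) \<partial>\<mu>)"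
    by (rule LIMSEQ_le_const2[OF tendsto_ennrealI[OF limit]])
      (use regularized_weighted_inequality_ennreal[OF f c phi_deriv phi'_cont phi'_nonneg] in auto)
  moreover have "Var \<mu> f \<le> (\<integral>x. (f x - c)\<^sup>2 \<partial>\<mu>)"
    by (intro Var_le_integral_square_diff alg_integrable alg_square f)
  ultimately show ?thesis using ennreal_leI order_trans by blast
qed

end

theorem theorem3p4:
  fixes \<mu> :: "(real ^ 'n) measure"
    and D \<A> :: "(real ^ 'n \<Rightarrow> real) set"
    and L :: "(real ^ 'n \<Rightarrow> real) \<Rightarrow> real ^ 'n \<Rightarrow> real"
    and \<phi> \<phi>' :: "real \<Rightarrow> real"
    and W LW :: "real ^ 'n \<Rightarrow> real"
    and b R \<kappa> :: real
  assumes diffusion: "symmetric_diffusion \<mu> D \<A> L"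
    and phi_deriv: "\<And>u. u \<ge> 1 \<Longrightarrow> (\<phi> has_real_derivative \<phi>' u) (at u within {1..})"
    and phi_C1: "continuous_on {1..} \<phi>'"
    and phi_pos: "\<And>u. u \<ge> 1 \<Longrightarrow> \<phi> u > 0"
    and phi_incr: "mono_on {1..} \<phi>"
    and phi_sublinear: "\<phi> \<in> O[at_top](\<lambda>u. u)"
    and W_ge_1: "\<And>x. W x \<ge> 1"
    and W_smooth: "smooth_enough \<mu> \<A> L W LW"
    and b_pos: "b > 0"
    and R_pos: "R > 0"
    and lyapunov: "AE x in \<mu>. LW x \<le> - \<phi> (W x) + b * indicator {x. norm x \<le> R} x"
    and local_poincare: "\<And>f. f \<in> \<A> \<Longrightarrow>
      (LINT x:{x. norm x \<le> R}|\<mu>. (f x)\<^sup>2) \<le>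
        \<kappa> * (\<integral>x. carre_du_champ L f f x \<partial>\<mu>)
        + inverse (measure \<mu> {x. norm x \<le> R}) * (LINT x:{x. norm x \<le> R}|\<mu>. f x)\<^sup>2"
  shows "(\<forall>f\<in>\<A>. ennreal (Var \<mu> f) \<le>
            ennreal (max (b * \<kappa> / \<phi> 1) 1) *
            (\<integral>\<^sup>+ x. (1 + 1 / ennreal (\<phi>' (W x))) * ennreal (carre_du_champ L f f x) \<partial>\<mu>)) \<and>
         (\<forall>f\<in>\<A>. (INF c::real. \<integral>x. (f x - c)\<^sup>2 * (\<phi> (W x) / W x) \<partial>\<mu>) \<le>
            (1 + b * \<kappa>) * (\<integral>x. carre_du_champ L f f x \<partial>\<mu>)) \<and>
         (\<exists>C::real. \<forall>s f. 0 < s \<longrightarrow> s < 1 \<longrightarrow> f \<in> \<A> \<longrightarrow>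
            Var \<mu> f \<le>
              C / quantile_inv (\<lambda>u. measure \<mu> {x. \<phi> (W x) < u * W x}) s
                * (\<integral>x. carre_du_champ L f f x \<partial>\<mu>)
              + s * (Osc \<mu> f)\<^sup>2)"
proof -
  have "{x. norm x \<le> R} = cball (0 :: real ^ 'n) R" by auto
  then have "{x. norm x \<le> R} \<in> sets \<mu>"
    using symmetric_diffusion.sets_eq_borel[OF diffusion] by simp
  moreover have "continuous_on {1..} \<phi>"
    by (rule DERIV_continuous_on[OF phi_deriv]) auto
  ultimately interpret lyapunov_poincare \<mu> D \<A> L W LW \<phi> b "{x. norm x \<le> R}" \<kappa>
    using diffusion W_smooth W_ge_1 phi_pos b_pos lyapunov local_poincare
    by (intro lyapunov_poincare.intro lyapunov_diffusion.intro lyapunov_diffusion_axioms.intro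
        lyapunov_poincare_axioms.intro) auto
  have "0 \<le> \<phi>' u" if "1 \<le> u" for u
    by (rule mono_on_Ici_imp_deriv_nonneg[OF phi_incr phi_deriv[OF that] that])
  then show ?thesis
    using weighted_poincare[OF _ phi_deriv phi_C1] converse_weighted_poincare weak_poincare by blast
qed

end
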